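(* Let $k=\mathbb F_2(s,t)$ be the field of fractions of the polynomial ring $\mathbb F_2[s,t]$ and let $L=\overline k$ be the perfect closure of $k$. Let $h=x^2+y^2+tx^4+sy^4\in k[x,y]$ (an irreducible polynomial), $A=k[x,y]/\langle h\rangle$ and $A_L=L\otimes_k A$. Then the base change map $$\Phi^{L,A}_4: L\otimes_k \mathrm{IDer}_k(A;4)\longrightarrow \mathrm{IDer}_L(A_L;4),\qquad c\otimes\delta\longmapsto c\,\widetilde\delta,$$ is not surjective.
   Context: All rings are commutative. For a ring $k$, a $k$-algebra $A$ and an integer $m\ge 1$, a Hasse-Schmidt derivation of $A$ over $k$ of length $m$ is a sequence $D=(D_0,D_1,\dots,D_m)$ of $k$-linear maps $D_i:A\to A$ with $D_0=\mathrm{Id}_A$ and $D_n(xy)=\sum_{i+j=n}D_i(x)D_j(y)$ for all $x,y\in A$ and all $n\le m$. In particular $D_1\in\mathrm{Der}_k(A)$. A derivation $\delta\in\mathrm{Der}_k(A)$ is $m$-integrable if there is a Hasse-Schmidt derivation $D$ of $A$ over $k$ of length $m$ with $D_1=\delta$; the set $\mathrm{IDer}_k(A;m)$ of $m$-integrable derivations is an $A$-submodule of $\mathrm{Der}_k(A)$. For $\delta\in\mathrm{Der}_k(A)$, $\widetilde\delta\in\mathrm{Der}_L(A_L)$ is its $L$-linear extension $\widetilde\delta(c\otimes a)=c\otimes\delta(a)$; if $\delta$ is $m$-integrable then so is $\widetilde\delta$, so $\Phi^{L,A}_m$ is well defined. *)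

theory Defs
  imports "HOL-Library.Z2" "HOL-Library.Poly_Mapping" "HOL-Algebra.Algebraic_Closure_Type"
begin

section \<open>Integrable derivations\<close>

locale comm_algebra = Modules.module scale
  for scale :: "'k::comm_ring_1 \<Rightarrow> 'a::comm_ring_1 \<Rightarrow> 'a" +
  assumes scale_mult_left: "scale c x * y = scale c (x * y)"

definition derivations :: "('k::comm_ring_1 \<Rightarrow> 'a::comm_ring_1 \<Rightarrow> 'a) \<Rightarrow> ('a \<Rightarrow> 'a) set" where
  "derivations scale =
     {\<delta>. module_hom scale scale \<delta> \<and> (\<forall>x y. \<delta> (x * y) = x * \<delta> y + \<delta> x * y)}"

text \<open>Only the terms \<open>D 0, \<dots>, D m\<close> of the sequence matter.\<close>

definition hasse_schmidt ::
    "('k::comm_ring_1 \<Rightarrow> 'a::comm_ring_1 \<Rightarrow> 'a) \<Rightarrow> nat \<Rightarrow> (nat \<Rightarrow> 'a \<Rightarrow> 'a) \<Rightarrow> bool" where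
  "hasse_schmidt scale m D \<longleftrightarrow>
     (\<forall>i\<le>m. module_hom scale scale (D i)) \<and> D 0 = id \<and>
     (\<forall>n\<le>m. \<forall>x y. D n (x * y) = (\<Sum>i\<le>n. D i x * D (n - i) y))"

definition IDer :: "('k::comm_ring_1 \<Rightarrow> 'a::comm_ring_1 \<Rightarrow> 'a) \<Rightarrow> nat \<Rightarrow> ('a \<Rightarrow> 'a) set" where
  "IDer scale m = {\<delta> \<in> derivations scale. \<exists>D. hasse_schmidt scale m D \<and> D 1 = \<delta>}"

lemma hasse_schmidt_D:
  assumes "hasse_schmidt scale m D"
  shows "i \<le> m \<Longrightarrow> module_hom scale scale (D i)" "D 0 = id"
    "n \<le> m \<Longrightarrow> D n (x * y) = (\<Sum>i\<le>n. D i x * D (n - i) y)"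
  using assms by (auto simp: hasse_schmidt_def)

lemma convolution4:
  fixes G :: "nat \<Rightarrow> nat \<Rightarrow> nat \<Rightarrow> nat \<Rightarrow> 'a::comm_monoid_add"
  shows "(\<Sum>i\<le>n. \<Sum>j\<le>n - i. \<Sum>p\<le>i. G p j (i - p) (n - i - j)) =
         (\<Sum>m\<le>n. \<Sum>p\<le>m. \<Sum>q\<le>n - m. G p (m - p) q (n - m - q))"
proof -
  have "(\<Sum>i\<le>n. \<Sum>j\<le>n - i. \<Sum>p\<le>i. G p j (i - p) (n - i - j)) =
     (\<Sum>(i, j, p) \<in> (SIGMA i:{..n}. SIGMA j:{..n - i}. {..i}). G p j (i - p) (n - i - j))"
    by (simp add: sum.Sigma)
  also have "\<dots> = (\<Sum>(m, p, q) \<in> (SIGMA m:{..n}. SIGMA p:{..m}. {..n - m}). G p (m - p) q (n - m - q))"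
    by (rule sum.reindex_bij_witness[where i = "\<lambda>(m, p, q). (p + q, m - p, p)"
          and j = "\<lambda>(i, j, p). (p + j, p, i - p)"])
       (auto simp: algebra_simps)
  also have "\<dots> = (\<Sum>m\<le>n. \<Sum>p\<le>m. \<Sum>q\<le>n - m. G p (m - p) q (n - m - q))"
    by (simp add: sum.Sigma)
  finally show ?thesis .
qed

context comm_algebra
begin

lemma scale_mult_right: "x * scale c y = scale c (x * y)"
  using scale_mult_left[of c y x] by (simp add: mult.commute)

lemma module_hom_iff:
  "module_hom scale scale f \<longleftrightarrow> (\<forall>x y. f (x + y) = f x + f y) \<and> (\<forall>c x. f (scale c x) = scale c (f x))"
  using module_axioms by (auto simp: module_hom_def module_hom_axioms_def)

lemma derivations_add:
  assumes "\<delta> \<in> derivations scale" "\<epsilon> \<in> derivations scale"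
  shows "(\<lambda>x. \<delta> x + \<epsilon> x) \<in> derivations scale"
  using assms by (auto simp: derivations_def module_hom_iff algebra_simps)

lemma derivations_mult:
  assumes "\<delta> \<in> derivations scale"
  shows "(\<lambda>x. a * \<delta> x) \<in> derivations scale"
  using assms by (auto simp: derivations_def module_hom_iff scale_mult_right algebra_simps)

lemma IDer_mult:
  assumes "\<delta> \<in> IDer scale m"
  shows "(\<lambda>x. a * \<delta> x) \<in> IDer scale m"
proof -
  obtain D where D: "hasse_schmidt scale m D" "D 1 = \<delta>" and d: "\<delta> \<in> derivations scale"
    using assms by (auto simp: IDer_def)
  have "hasse_schmidt scale m (\<lambda>i x. a ^ i * D i x)"
    unfolding hasse_schmidt_def
  proof (intro conjI allI impI)
    fix i assume "i \<le> m"
    then show "module_hom scale scale (\<lambda>x. a ^ i * D i x)"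
      using hasse_schmidt_D(1)[OF D(1), of i]
      by (auto simp: module_hom_iff scale_mult_right algebra_simps)
  next
    show "(\<lambda>x. a ^ 0 * D 0 x) = id" using hasse_schmidt_D(2)[OF D(1)] by auto
  next
    fix n x y assume "n \<le> m"
    have "a ^ n = a ^ i * a ^ (n - i)" if "i \<le> n" for i
      using that by (simp flip: power_add)
    then show "a ^ n * D n (x * y) = (\<Sum>i\<le>n. a ^ i * D i x * (a ^ (n - i) * D (n - i) y))"
      unfolding hasse_schmidt_D(3)[OF D(1) \<open>n \<le> m\<close>] sum_distrib_left
      by (intro sum.cong) (auto simp: algebra_simps)
  qed
  then show ?thesis
    using derivations_mult[OF d] D(2) by (force simp: IDer_def)
qed

lemma IDer_add:
  assumes "\<delta> \<in> IDer scale m" "\<epsilon> \<in> IDer scale m"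
  shows "(\<lambda>x. \<delta> x + \<epsilon> x) \<in> IDer scale m"
proof (cases "m = 0")
  case True
  have "hasse_schmidt scale 0 (\<lambda>i. if i = 0 then id else (\<lambda>x. \<delta> x + \<epsilon> x))"
    by (auto simp: hasse_schmidt_def module_hom_iff)
  then have "\<exists>D. hasse_schmidt scale 0 D \<and> D 1 = (\<lambda>x. \<delta> x + \<epsilon> x)" by force
  then show ?thesis using assms derivations_add True by (auto simp: IDer_def)
next
  case False
  obtain D where D: "hasse_schmidt scale m D" "D 1 = \<delta>" and d: "\<delta> \<in> derivations scale"
    using assms(1) by (auto simp: IDer_def)
  obtain E where E: "hasse_schmidt scale m E" "E 1 = \<epsilon>" and e: "\<epsilon> \<in> derivations scale"
    using assms(2) by (auto simp: IDer_def)
  define F where "F n x = (\<Sum>i\<le>n. D i (E (n - i) x))" for n x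
  have Dsum: "D i (sum f S) = (\<Sum>j\<in>S. D i (f j))" if "i \<le> m" for i f and S :: "nat set"
    by (rule module_hom.sum[OF hasse_schmidt_D(1)[OF D(1) that]])
  have "hasse_schmidt scale m F"
    unfolding hasse_schmidt_def
  proof (intro conjI allI impI)
    fix n assume n: "n \<le> m"
    have "module_hom scale scale (D i)" "module_hom scale scale (E (n - i))" if "i \<le> n" for i
      using n that hasse_schmidt_D(1)[OF D(1)] hasse_schmidt_D(1)[OF E(1)] by auto
    then show "module_hom scale scale (F n)"
      by (simp add: module_hom_iff F_def sum.distrib scale_sum_right)
  next
    show "F 0 = id"
      using hasse_schmidt_D(2)[OF D(1)] hasse_schmidt_D(2)[OF E(1)] by (auto simp: F_def)
  next
    fix n x y assume n: "n \<le> m"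
    have "F n (x * y) =
        (\<Sum>i\<le>n. \<Sum>j\<le>n - i. \<Sum>p\<le>i. D p (E j x) * D (i - p) (E (n - i - j) y))"
      unfolding F_def using n
      by (intro sum.cong) (auto simp: hasse_schmidt_D(3)[OF E(1)] hasse_schmidt_D(3)[OF D(1)] Dsum)
    also have "\<dots> = (\<Sum>k\<le>n. \<Sum>p\<le>k. \<Sum>q\<le>n - k. D p (E (k - p) x) * D q (E (n - k - q) y))"
      by (rule convolution4)
    also have "\<dots> = (\<Sum>k\<le>n. F k x * F (n - k) y)"
      by (simp add: F_def sum_product)
    finally show "F n (x * y) = (\<Sum>k\<le>n. F k x * F (n - k) y)" .
  qed
  moreover have "F 1 = (\<lambda>x. \<delta> x + \<epsilon> x)"
    using hasse_schmidt_D(2)[OF D(1)] hasse_schmidt_D(2)[OF E(1)] D(2) E(2)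
    by (auto simp: F_def add.commute)
  ultimately show ?thesis
    using derivations_add[OF d e] by (auto simp: IDer_def)
qed

lemma IDer_zero: "(\<lambda>x. 0) \<in> IDer scale m"
proof -
  have "hasse_schmidt scale m (\<lambda>i. if i = 0 then id else (\<lambda>x. 0))"
    unfolding hasse_schmidt_def
  proof (intro conjI allI impI)
    fix n :: nat and x y :: 'a
    show "(if n = 0 then id else (\<lambda>x. 0)) (x * y) =
      (\<Sum>i\<le>n. (if i = 0 then id else (\<lambda>x. 0)) x * (if n - i = 0 then id else (\<lambda>x. 0)) y)"
      by (cases n) (auto intro!: sum.neutral[symmetric])
  qed (auto simp: module_hom_iff)
  moreover have "(\<lambda>x. 0) \<in> derivations scale" by (auto simp: derivations_def module_hom_iff)
  ultimately show ?thesis by (force simp: IDer_def)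
qed

lemma IDer_uminus:
  assumes "\<delta> \<in> IDer scale m"
  shows "(\<lambda>x. - \<delta> x) \<in> IDer scale m"
  using IDer_mult[OF assms, of "-1"] by simp

lemma IDer_diff:
  assumes "\<delta> \<in> IDer scale m" "\<epsilon> \<in> IDer scale m"
  shows "(\<lambda>x. \<delta> x - \<epsilon> x) \<in> IDer scale m"
  using IDer_add[OF assms(1) IDer_uminus[OF assms(2)]] by simp

lemma IDer_scale:
  assumes "\<delta> \<in> IDer scale m"
  shows "(\<lambda>x. scale c (\<delta> x)) \<in> IDer scale m"
  using IDer_mult[OF assms, of "scale c 1"] by (simp add: scale_mult_left)

end

section \<open>The base field and its vector spaces\<close>

text \<open>The fraction field of \<open>F\<^sub>2[t][s]\<close>, where \<open>F\<^sub>2\<close> is the type \<^typ>\<open>bit\<close>; the outer polynomial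
  variable is \<open>s\<close>.\<close>

type_synonym kk = "bit poly poly fract"

definition s_kk :: kk where "s_kk = Fract [:0, 1:] 1"
definition t_kk :: kk where "t_kk = Fract [:[:0, 1:]:] 1"

class kmod = ab_group_add +
  fixes kscale :: "kk \<Rightarrow> 'a \<Rightarrow> 'a" (infixr "*\<^sub>k" 75)
  assumes kscale_add_right: "c *\<^sub>k (x + y) = c *\<^sub>k x + c *\<^sub>k y"
    and kscale_add_left: "(c + d) *\<^sub>k x = c *\<^sub>k x + d *\<^sub>k x"
    and kscale_kscale: "c *\<^sub>k (d *\<^sub>k x) = (c * d) *\<^sub>k x"
    and kscale_one: "1 *\<^sub>k x = x"

class kalg = kmod + comm_ring_1 +
  assumes kscale_mult_left: "(c *\<^sub>k x) * y = c *\<^sub>k (x * y)"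

global_interpretation kmod: vector_space "kscale :: kk \<Rightarrow> 'a \<Rightarrow> 'a::kmod"
  by unfold_locales (auto simp: kscale_add_right kscale_add_left kscale_kscale kscale_one)

global_interpretation kalg: comm_algebra "kscale :: kk \<Rightarrow> 'a \<Rightarrow> 'a::kalg"
  by unfold_locales (auto simp: kscale_mult_left)

section \<open>Tensor products over \<open>k\<close>\<close>

definition fscale :: "kk \<Rightarrow> ('x \<Rightarrow>\<^sub>0 kk) \<Rightarrow> ('x \<Rightarrow>\<^sub>0 kk)" where
  "fscale c p = Poly_Mapping.map ((*) c) p"

lemma lookup_fscale [simp]: "Poly_Mapping.lookup (fscale c p) x = c * Poly_Mapping.lookup p x"
  by (simp add: fscale_def map.rep_eq when_def)

global_interpretation free: vector_space fscale
  by unfold_locales (auto intro!: poly_mapping_eqI simp: lookup_add algebra_simps)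

definition pair :: "'a \<Rightarrow> 'b \<Rightarrow> ('a \<times> 'b) \<Rightarrow>\<^sub>0 kk" where
  "pair a b = Poly_Mapping.single (a, b) 1"

definition bilinear_relations :: "(('a::kmod \<times> 'b::kmod) \<Rightarrow>\<^sub>0 kk) set" where
  "bilinear_relations =
     {pair (a + a') b - pair a b - pair a' b |a a' b. True} \<union>
     {pair a (b + b') - pair a b - pair a b' |a b b'. True} \<union>
     {pair (c *\<^sub>k a) b - fscale c (pair a b) |c a b. True} \<union>
     {pair a (c *\<^sub>k b) - fscale c (pair a b) |c a b. True}"

text \<open>\<open>M \<otimes>\<^sub>k N\<close> is the free \<open>k\<close>-module on \<open>M \<times> N\<close> modulo the span of the bilinear relations.\<close>

quotient_type (overloaded) ('a, 'b) tensor =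
  "('a::kmod \<times> 'b::kmod) \<Rightarrow>\<^sub>0 kk" / "\<lambda>p q. p - q \<in> free.span bilinear_relations"
proof (rule equivpI)
  show "reflp (\<lambda>p q. p - q \<in> free.span (bilinear_relations :: (('a \<times> 'b) \<Rightarrow>\<^sub>0 kk) set))"
    by (auto simp: reflp_def free.span_zero)
  show "symp (\<lambda>p q. p - q \<in> free.span (bilinear_relations :: (('a \<times> 'b) \<Rightarrow>\<^sub>0 kk) set))"
    by (auto simp: symp_def dest: free.span_neg)
  show "transp (\<lambda>p q. p - q \<in> free.span (bilinear_relations :: (('a \<times> 'b) \<Rightarrow>\<^sub>0 kk) set))"
    unfolding transp_def using free.span_add by fastforce
qed

instantiation tensor :: (kmod, kmod) kmod
begin

lift_definition zero_tensor :: "('a, 'b) tensor" is 0 .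

lift_definition plus_tensor :: "('a, 'b) tensor \<Rightarrow> ('a, 'b) tensor \<Rightarrow> ('a, 'b) tensor" is "(+)"
  using free.span_add by (fastforce simp: algebra_simps)

lift_definition uminus_tensor :: "('a, 'b) tensor \<Rightarrow> ('a, 'b) tensor" is uminus
  using free.span_neg by (fastforce simp: algebra_simps)

lift_definition minus_tensor :: "('a, 'b) tensor \<Rightarrow> ('a, 'b) tensor \<Rightarrow> ('a, 'b) tensor" is "(-)"
proof -
  fix p p' q q' :: "('a \<times> 'b) \<Rightarrow>\<^sub>0 kk"
  assume "p - p' \<in> free.span bilinear_relations" "q - q' \<in> free.span bilinear_relations"
  from free.span_diff[OF this] show "p - q - (p' - q') \<in> free.span bilinear_relations"
    by (simp add: algebra_simps)
qed

lift_definition kscale_tensor :: "kk \<Rightarrow> ('a, 'b) tensor \<Rightarrow> ('a, 'b) tensor" is fscale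
proof -
  fix c and p q :: "('a \<times> 'b) \<Rightarrow>\<^sub>0 kk"
  assume "p - q \<in> free.span bilinear_relations"
  from free.span_scale[OF this] show "fscale c p - fscale c q \<in> free.span bilinear_relations"
    by (simp add: free.scale_right_diff_distrib)
qed

instance
proof
  fix a b c :: "('a, 'b) tensor" and r r' :: kk
  show "a + b + c = a + (b + c)" by transfer (simp add: free.span_zero algebra_simps)
  show "a + b = b + a" by transfer (simp add: free.span_zero algebra_simps)
  show "0 + a = a" by transfer (simp add: free.span_zero)
  show "- a + a = 0" by transfer (simp add: free.span_zero)
  show "a - b = a + - b" by transfer (simp add: free.span_zero)
  show "r *\<^sub>k (a + b) = r *\<^sub>k a + r *\<^sub>k b"
    by transfer (simp add: free.span_zero free.scale_right_distrib)
  show "(r + r') *\<^sub>k a = r *\<^sub>k a + r' *\<^sub>k a"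
    by transfer (simp add: free.span_zero free.scale_left_distrib)
  show "r *\<^sub>k (r' *\<^sub>k a) = (r * r') *\<^sub>k a"
    by transfer (simp add: free.span_zero)
  show "1 *\<^sub>k a = a" by transfer (simp add: free.span_zero)
qed

end

lift_definition tens :: "'a::kmod \<Rightarrow> 'b::kmod \<Rightarrow> ('a, 'b) tensor" (infixl "\<otimes>\<^sub>k" 72) is pair .

lemma tens_add_left: "(a + a') \<otimes>\<^sub>k b = a \<otimes>\<^sub>k b + a' \<otimes>\<^sub>k b"
proof (transfer)
  fix a a' :: 'a and b :: 'b
  have "pair (a + a') b - pair a b - pair a' b \<in> bilinear_relations"
    unfolding bilinear_relations_def by blast
  then show "pair (a + a') b - (pair a b + pair a' b) \<in> free.span bilinear_relations"
    by (simp add: free.span_base diff_diff_eq)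
qed

lemma tens_add_right: "a \<otimes>\<^sub>k (b + b') = a \<otimes>\<^sub>k b + a \<otimes>\<^sub>k b'"
proof (transfer)
  fix a :: 'a and b b' :: 'b
  have "pair a (b + b') - pair a b - pair a b' \<in> bilinear_relations"
    unfolding bilinear_relations_def by blast
  then show "pair a (b + b') - (pair a b + pair a b') \<in> free.span bilinear_relations"
    by (simp add: free.span_base diff_diff_eq)
qed

lemma tens_scale_left: "(c *\<^sub>k a) \<otimes>\<^sub>k b = c *\<^sub>k (a \<otimes>\<^sub>k b)"
  by transfer (rule free.span_base, unfold bilinear_relations_def, blast)

lemma tens_scale_right: "a \<otimes>\<^sub>k (c *\<^sub>k b) = c *\<^sub>k (a \<otimes>\<^sub>k b)"
  by transfer (rule free.span_base, unfold bilinear_relations_def, blast)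

lemma tensor_abs_cases:
  obtains p where "t = abs_tensor p"
  using Quotient3_abs_rep[OF Quotient3_tensor, of t] by metis

lemma tensor_induct [case_names tens add]:
  assumes tens: "\<And>a b. P (a \<otimes>\<^sub>k b)" and add: "\<And>t u. P t \<Longrightarrow> P u \<Longrightarrow> P (t + u)"
  shows "P t"
proof -
  have single: "abs_tensor (Poly_Mapping.single (a, b) c) = (c *\<^sub>k a) \<otimes>\<^sub>k b"
    for a :: 'a and b :: 'b and c
  proof -
    have "Poly_Mapping.single (a, b) c = fscale c (pair a b)"
      by (rule poly_mapping_eqI) (simp add: pair_def lookup_single when_def)
    moreover have "c *\<^sub>k (a \<otimes>\<^sub>k b) = abs_tensor (fscale c (pair a b))"
      by (simp only: kscale_tensor.abs_eq tens.abs_eq)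
    ultimately show ?thesis by (simp only: tens_scale_left)
  qed
  have "0 = (0 :: 'a) \<otimes>\<^sub>k (0 :: 'b)"
    using tens_scale_left[of 0 0 0] by simp
  then have zero: "P 0" using tens by metis
  have sum: "P (\<Sum>x\<in>S. f x)" if "finite S" "\<And>x. x \<in> S \<Longrightarrow> P (f x)"
    for S :: "('a \<times> 'b) set" and f
    using that by (induction S rule: finite_induct) (auto simp: zero add)
  have abs_sum: "abs_tensor (\<Sum>x\<in>S. f x) = (\<Sum>x\<in>S. abs_tensor (f x))"
    for S and f :: "('a \<times> 'b) \<Rightarrow> ('a \<times> 'b) \<Rightarrow>\<^sub>0 kk"
    by (induction S rule: infinite_finite_induct)
       (auto simp: zero_tensor.abs_eq plus_tensor.abs_eq[symmetric])
  show ?thesis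
  proof -
    obtain p where t: "t = abs_tensor p" by (rule tensor_abs_cases)
    have "p = (\<Sum>x\<in>Poly_Mapping.keys p. Poly_Mapping.single x (Poly_Mapping.lookup p x))"
      by (rule poly_mapping_eqI)
         (simp add: lookup_sum lookup_single when_def sum.delta' in_keys_iff)
    then have "t = (\<Sum>x\<in>Poly_Mapping.keys p. abs_tensor (Poly_Mapping.single x (Poly_Mapping.lookup p x)))"
      using t abs_sum by metis
    moreover have "P (abs_tensor (Poly_Mapping.single x c))" for x c
      by (cases x) (auto simp: single tens)
    ultimately show ?thesis by (auto intro: sum)
  qed
qed

text \<open>The linear map induced by a bilinear map via the universal property; it is meaningful only
  if \<open>B\<close> is bilinear.\<close>

definition free_lift :: "('a \<Rightarrow> 'b \<Rightarrow> 'c::kmod) \<Rightarrow> (('a \<times> 'b) \<Rightarrow>\<^sub>0 kk) \<Rightarrow> 'c" where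
  "free_lift B p = (\<Sum>x\<in>Poly_Mapping.keys p. Poly_Mapping.lookup p x *\<^sub>k B (fst x) (snd x))"

definition tensor_lift :: "('a::kmod \<Rightarrow> 'b::kmod \<Rightarrow> 'c::kmod) \<Rightarrow> ('a, 'b) tensor \<Rightarrow> 'c" where
  "tensor_lift B t = free_lift B (rep_tensor t)"

definition kbilinear :: "('a::kmod \<Rightarrow> 'b::kmod \<Rightarrow> 'c::kmod) \<Rightarrow> bool" where
  "kbilinear B \<longleftrightarrow>
     (\<forall>a a' b. B (a + a') b = B a b + B a' b) \<and> (\<forall>a b b'. B a (b + b') = B a b + B a b') \<and>
     (\<forall>c a b. B (c *\<^sub>k a) b = c *\<^sub>k B a b) \<and> (\<forall>c a b. B a (c *\<^sub>k b) = c *\<^sub>k B a b)"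

lemma free_lift_superset:
  assumes "finite S" "Poly_Mapping.keys p \<subseteq> S"
  shows "free_lift B p = (\<Sum>x\<in>S. Poly_Mapping.lookup p x *\<^sub>k B (fst x) (snd x))"
  unfolding free_lift_def using assms
  by (intro sum.mono_neutral_left) (auto simp: in_keys_iff)

lemma free_lift_hom: "module_hom fscale kscale (free_lift B)"
proof unfold_locales
  fix p q :: "('a \<times> 'b) \<Rightarrow>\<^sub>0 kk"
  have *: "finite (Poly_Mapping.keys p \<union> Poly_Mapping.keys q)" by simp
  show "free_lift B (p + q) = free_lift B p + free_lift B q"
    using free_lift_superset[OF *, of p B] free_lift_superset[OF *, of q B]
      free_lift_superset[OF *, of "p + q" B] Poly_Mapping.keys_add[of p q]
    by (simp add: lookup_add kscale_add_left sum.distrib)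
next
  fix c and p :: "('a \<times> 'b) \<Rightarrow>\<^sub>0 kk"
  have "Poly_Mapping.keys (fscale c p) \<subseteq> Poly_Mapping.keys p" by (auto simp: in_keys_iff)
  then show "free_lift B (fscale c p) = c *\<^sub>k free_lift B p"
    using free_lift_superset[of "Poly_Mapping.keys p" "fscale c p" B]
    by (simp add: free_lift_def kmod.scale_sum_right)
qed

lemma free_lift_pair: "free_lift B (pair a b) = B a b"
  by (simp add: free_lift_def pair_def)

lemma free_lift_relations:
  assumes "kbilinear B" "p \<in> free.span bilinear_relations"
  shows "free_lift B p = 0"
proof -
  interpret module_hom fscale kscale "free_lift B" by (rule free_lift_hom)
  have "free_lift B p = 0" if "p \<in> bilinear_relations" for p
    using that assms(1)
    by (auto simp: bilinear_relations_def diff scale free_lift_pair kbilinear_def)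
  then have "free.span bilinear_relations \<subseteq> {p. free_lift B p = 0}"
    by (intro free.span_minimal) (auto simp: free.subspace_def zero add scale)
  then show ?thesis using assms(2) by auto
qed

lemma tensor_lift_abs:
  assumes "kbilinear B"
  shows "tensor_lift B (abs_tensor p) = free_lift B p"
proof -
  have "rep_tensor (abs_tensor p) - p \<in> free.span bilinear_relations"
    using Quotient3_rep_abs[OF Quotient3_tensor, of p] by (simp add: free.span_zero)
  then have "free_lift B (rep_tensor (abs_tensor p) - p) = 0"
    by (rule free_lift_relations[OF assms])
  then show ?thesis
    by (simp add: tensor_lift_def module_hom.diff[OF free_lift_hom])
qed

lemma tensor_lift_tens: "kbilinear B \<Longrightarrow> tensor_lift B (a \<otimes>\<^sub>k b) = B a b"
  by (simp add: tens.abs_eq tensor_lift_abs free_lift_pair)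

lemma tensor_lift_add:
  assumes "kbilinear B" shows "tensor_lift B (t + u) = tensor_lift B t + tensor_lift B u"
proof -
  obtain p q where "t = abs_tensor p" "u = abs_tensor q"
    using tensor_abs_cases by metis
  then show ?thesis
    by (simp add: plus_tensor.abs_eq tensor_lift_abs[OF assms] module_hom.add[OF free_lift_hom])
qed

lemma tensor_lift_scale:
  assumes "kbilinear B" shows "tensor_lift B (c *\<^sub>k t) = c *\<^sub>k tensor_lift B t"
proof -
  obtain p where "t = abs_tensor p" by (rule tensor_abs_cases)
  then show ?thesis
    by (simp add: kscale_tensor.abs_eq tensor_lift_abs[OF assms] module_hom.scale[OF free_lift_hom])
qed

lemma kbilinear_add: "kbilinear B \<Longrightarrow> kbilinear B' \<Longrightarrow> kbilinear (\<lambda>a b. B a b + B' a b)"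
  by (simp add: kbilinear_def kscale_add_right)

subsection \<open>Tensor products of \<open>k\<close>-algebras\<close>

instantiation tensor :: (kalg, kalg) kalg
begin

definition one_tensor :: "('a, 'b) tensor" where "1 = 1 \<otimes>\<^sub>k 1"

definition times_tensor :: "('a, 'b) tensor \<Rightarrow> ('a, 'b) tensor \<Rightarrow> ('a, 'b) tensor" where
  "t * u = tensor_lift (\<lambda>a b. tensor_lift (\<lambda>a' b'. (a * a') \<otimes>\<^sub>k (b * b')) u) t"

lemma kbilinear_times_inner:
  "kbilinear (\<lambda>a' b'. (a * a') \<otimes>\<^sub>k (b * b') :: ('a, 'b) tensor)"
  by (simp add: kbilinear_def distrib_left tens_add_left tens_add_right
      tens_scale_left tens_scale_right kalg.scale_mult_right)

lemma kbilinear_times_left: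
  "kbilinear (\<lambda>a b. (a * a') \<otimes>\<^sub>k (b * b') :: ('a, 'b) tensor)"
  by (simp add: kbilinear_def distrib_right tens_add_left tens_add_right
      tens_scale_left tens_scale_right kscale_mult_left)

lemma kbilinear_times_outer:
  "kbilinear (\<lambda>a b. tensor_lift (\<lambda>a' b'. (a * a') \<otimes>\<^sub>k (b * b')) (u :: ('a, 'b) tensor))"
proof (induction u rule: tensor_induct)
  case (tens a b)
  show ?case
    by (simp only: tensor_lift_tens kbilinear_times_inner kbilinear_times_left)
next
  case (add t u)
  then show ?case
    by (simp only: tensor_lift_add[OF kbilinear_times_inner] kbilinear_add)
qed

lemma tens_times_tens: "(a \<otimes>\<^sub>k b) * (a' \<otimes>\<^sub>k b') = ((a * a') \<otimes>\<^sub>k (b * b') :: ('a, 'b) tensor)"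
  unfolding times_tensor_def
  by (simp only: tensor_lift_tens[OF kbilinear_times_outer] tensor_lift_tens[OF kbilinear_times_inner]
      tensor_lift_tens[OF kbilinear_times_left])

lemma times_tensor_add_left: "(t + u) * v = t * v + (u * v :: ('a, 'b) tensor)"
  unfolding times_tensor_def by (simp only: tensor_lift_add kbilinear_times_outer)

lemma times_tensor_add_right: "v * (t + u) = v * t + (v * u :: ('a, 'b) tensor)"
proof (induction v rule: tensor_induct)
  case (tens a b)
  have "(a \<otimes>\<^sub>k b) * w = tensor_lift (\<lambda>a' b'. (a * a') \<otimes>\<^sub>k (b * b')) w" for w
    unfolding times_tensor_def by (simp only: tensor_lift_tens[OF kbilinear_times_outer])
  then show ?case by (simp only: tensor_lift_add[OF kbilinear_times_inner])
next
  case (add v w)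
  then show ?case by (simp add: times_tensor_add_left algebra_simps)
qed

lemma zero_neq_one_tensor: "0 \<noteq> (1 :: ('a, 'b) tensor)"
proof
  assume *: "0 = (1 :: ('a, 'b) tensor)"
  interpret vector_space_pair "kscale :: kk \<Rightarrow> 'a \<Rightarrow> 'a" "(*) :: kk \<Rightarrow> kk \<Rightarrow> kk"
    by unfold_locales (auto simp: algebra_simps)
  have "kmod.independent {1 :: 'a}" by simp
  from linear_independent_extend[OF this, of "\<lambda>_. 1"]
  obtain g :: "'a \<Rightarrow> kk" where g: "Vector_Spaces.linear kscale (*) g" "g 1 = 1" by auto
  interpret g: Vector_Spaces.linear kscale "(*)" g by (fact g(1))
  have bil: "kbilinear (\<lambda>a b. g a *\<^sub>k b :: 'b)"
    by (simp add: kbilinear_def g.add g.scale kscale_add_left kscale_add_right mult.commute)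
  have "tensor_lift (\<lambda>a b. g a *\<^sub>k b :: 'b) 1 = 1"
    by (simp add: one_tensor_def tensor_lift_tens[OF bil] g(2))
  moreover have "tensor_lift (\<lambda>a b. g a *\<^sub>k b :: 'b) 0 = 0"
    using tensor_lift_scale[OF bil, of 0 0] by simp
  ultimately show False using * by simp
qed

instance
proof
  fix t u v :: "('a, 'b) tensor" and c :: kk
  show "0 \<noteq> (1 :: ('a, 'b) tensor)" by (rule zero_neq_one_tensor)
  show "(t + u) * v = t * v + u * v" by (rule times_tensor_add_left)
  show "t * u = u * t"
  proof (induction t rule: tensor_induct)
    case (tens a b)
    show ?case
      by (induction u rule: tensor_induct)
         (simp_all add: tens_times_tens times_tensor_add_left times_tensor_add_right mult.commute)
  qed (simp add: times_tensor_add_left times_tensor_add_right)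
  show "t * u * v = t * (u * v)"
  proof (induction t rule: tensor_induct)
    case (tens a b)
    show ?case
    proof (induction u rule: tensor_induct)
      case (tens a' b')
      show ?case
        by (induction v rule: tensor_induct)
           (simp_all add: tens_times_tens times_tensor_add_right mult.assoc)
    qed (simp add: times_tensor_add_left times_tensor_add_right)
  qed (simp add: times_tensor_add_left)
  show "1 * t = t"
    by (induction t rule: tensor_induct)
       (simp_all add: one_tensor_def tens_times_tens times_tensor_add_right)
  show "(c *\<^sub>k t) * u = c *\<^sub>k (t * u)"
    unfolding times_tensor_def by (simp only: tensor_lift_scale kbilinear_times_outer)
qed

end

section \<open>Base change of derivations\<close>

text \<open>\<open>L \<otimes>\<^sub>k A\<close> as an \<open>L\<close>-algebra, and the \<open>L\<close>-linear extension of a \<open>k\<close>-linear map on \<open>A\<close>.\<close>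

definition lscale :: "'l::kalg \<Rightarrow> ('l, 'a::kalg) tensor \<Rightarrow> ('l, 'a) tensor" where
  "lscale c t = (c \<otimes>\<^sub>k 1) * t"

definition extend_scalars :: "('a::kalg \<Rightarrow> 'a) \<Rightarrow> ('l::kalg, 'a) tensor \<Rightarrow> ('l, 'a) tensor" where
  "extend_scalars \<delta> = tensor_lift (\<lambda>c a. c \<otimes>\<^sub>k \<delta> a)"

lemma lscale_tens: "lscale c (d \<otimes>\<^sub>k a) = (c * d) \<otimes>\<^sub>k a"
  by (simp add: lscale_def tens_times_tens)

global_interpretation lalg: comm_algebra "lscale :: 'l::kalg \<Rightarrow> ('l, 'a::kalg) tensor \<Rightarrow> ('l, 'a) tensor"
  by unfold_locales
     (auto simp: lscale_def tens_add_left distrib_left distrib_right tens_times_tens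
       one_tensor_def[symmetric] simp flip: mult.assoc)

lemma kbilinear_extend:
  fixes \<delta> :: "'a::kalg \<Rightarrow> 'a"
  assumes "module_hom kscale kscale \<delta>"
  shows "kbilinear (\<lambda>c a. c \<otimes>\<^sub>k \<delta> a)"
  using assms by (auto simp: kalg.module_hom_iff kbilinear_def tens_add_left tens_add_right
      tens_scale_left tens_scale_right)

lemma extend_tens:
  "module_hom kscale kscale \<delta> \<Longrightarrow> extend_scalars \<delta> (c \<otimes>\<^sub>k a) = c \<otimes>\<^sub>k \<delta> a"
  unfolding extend_scalars_def by (rule tensor_lift_tens[OF kbilinear_extend])

lemma extend_add:
  "module_hom kscale kscale \<delta> \<Longrightarrow> extend_scalars \<delta> (t + u) = extend_scalars \<delta> t + extend_scalars \<delta> u"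
  unfolding extend_scalars_def by (rule tensor_lift_add[OF kbilinear_extend])

lemma extend_hom:
  assumes "module_hom kscale kscale \<delta>"
  shows "module_hom lscale lscale (extend_scalars \<delta>)"
  unfolding lalg.module_hom_iff
proof (intro conjI allI)
  fix c t
  show "extend_scalars \<delta> (lscale c t) = lscale c (extend_scalars \<delta> t)"
    by (induction t rule: tensor_induct)
       (simp_all add: lscale_tens extend_tens[OF assms] extend_add[OF assms]
         lalg.scale_right_distrib)
qed (rule extend_add[OF assms])

lemma extend_derivations:
  assumes "\<delta> \<in> derivations kscale"
  shows "(extend_scalars \<delta> :: ('l::kalg, 'a::kalg) tensor \<Rightarrow> _) \<in> derivations lscale"
proof -
  have hom: "module_hom kscale kscale \<delta>" and leib: "\<delta> (x * y) = x * \<delta> y + \<delta> x * y" for x y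
    using assms by (auto simp: derivations_def)
  have "extend_scalars \<delta> (t * u) = t * extend_scalars \<delta> u + extend_scalars \<delta> t * u"
    for t u :: "('l, 'a) tensor"
  proof (induction t rule: tensor_induct)
    case (tens a b)
    show ?case
      by (induction u rule: tensor_induct)
         (simp_all add: tens_times_tens extend_tens[OF hom] extend_add[OF hom] leib
           tens_add_right algebra_simps)
  qed (simp add: extend_add[OF hom] algebra_simps)
  then show ?thesis using extend_hom[OF hom] by (simp add: derivations_def)
qed

lemma tens_sum_right: "a \<otimes>\<^sub>k (\<Sum>i\<in>I. f i) = (\<Sum>i\<in>I. a \<otimes>\<^sub>k f i)"
proof -
  have "a \<otimes>\<^sub>k 0 = 0" using tens_scale_right[of a 0 0] by simp
  then show ?thesis
    by (induction I rule: infinite_finite_induct) (auto simp: tens_add_right)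
qed

lemma extend_hasse_schmidt:
  assumes "hasse_schmidt kscale m D"
  shows "hasse_schmidt lscale m (\<lambda>i. extend_scalars (D i) :: ('l::kalg, 'a::kalg) tensor \<Rightarrow> _)"
  unfolding hasse_schmidt_def
proof (intro conjI allI impI)
  fix i assume "i \<le> m"
  then show "module_hom lscale lscale (extend_scalars (D i))"
    by (intro extend_hom hasse_schmidt_D(1)[OF assms])
next
  have "module_hom kscale kscale (D 0)" by (intro hasse_schmidt_D(1)[OF assms]) simp
  then have hom: "module_hom kscale kscale (id :: 'a \<Rightarrow> 'a)" by (simp only: hasse_schmidt_D(2)[OF assms])
  have "extend_scalars id t = t" for t :: "('l, 'a) tensor"
  proof (induction t rule: tensor_induct)
    case (tens a b)
    show ?case by (subst extend_tens[OF hom]) simp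
  next
    case (add t u)
    then show ?case by (subst extend_add[OF hom]) (simp only:)
  qed
  then show "extend_scalars (D 0) = (id :: ('l, 'a) tensor \<Rightarrow> _)"
    by (auto simp only: hasse_schmidt_D(2)[OF assms] id_apply fun_eq_iff)
next
  fix n and t u :: "('l, 'a) tensor" assume n: "n \<le> m"
  have hom: "module_hom kscale kscale (D i)" if "i \<le> n" for i
    using that n by (intro hasse_schmidt_D(1)[OF assms]) simp
  note ext = extend_tens[OF hom] extend_add[OF hom]
  show "extend_scalars (D n) (t * u) = (\<Sum>i\<le>n. extend_scalars (D i) t * extend_scalars (D (n - i)) u)"
  proof (induction t rule: tensor_induct)
    case (tens a b)
    show ?case
      by (induction u rule: tensor_induct)
         (simp_all add: tens_times_tens ext hasse_schmidt_D(3)[OF assms n] tens_sum_right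
           distrib_left sum.distrib)
  qed (simp add: ext distrib_right sum.distrib)
qed

lemma extend_IDer: "\<delta> \<in> IDer kscale m \<Longrightarrow> extend_scalars \<delta> \<in> IDer lscale m"
  using extend_derivations extend_hasse_schmidt unfolding IDer_def by blast

section \<open>The perfect closure of \<open>k\<close>\<close>

lemma kk_char2: "(2 :: kk) = 0"
proof -
  have "(1 :: bit poly poly) + 1 = 0" by (simp add: poly_eq_iff coeff_add one_pCons)
  then have "(1 :: kk) + 1 = 0" by (simp add: One_fract_def Zero_fract_def)
  then show ?thesis by simp
qed

lemma ac_char2: "(2 :: kk alg_closure) = 0"
  using to_ac_numeral[where 'a = kk, of "num.Bit0 num.One"] by (simp only: kk_char2 to_ac_0)

lemma frobenius_add:
  fixes x y :: "kk alg_closure"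
  shows "(x + y) ^ (2 ^ n) = x ^ (2 ^ n) + y ^ (2 ^ n)"
proof (induction n)
  case (Suc n)
  have "(x + y) ^ (2 ^ Suc n) = ((x + y) ^ (2 ^ n)) ^ 2"
    by (simp add: mult.commute flip: power_mult)
  also have "\<dots> = (x ^ (2 ^ n)) ^ 2 + (y ^ (2 ^ n)) ^ 2"
    by (simp add: Suc power2_sum ac_char2)
  also have "\<dots> = x ^ (2 ^ Suc n) + y ^ (2 ^ Suc n)"
    by (simp add: mult.commute flip: power_mult)
  finally show ?case .
qed simp

text \<open>As a subfield of an algebraic closure: all \<open>2^n\<close>-th roots of elements of \<open>k\<close>.\<close>

definition perfect_closure :: "kk alg_closure set" where
  "perfect_closure = {z. \<exists>n. z ^ (2 ^ n) \<in> range to_ac}"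

lemma perfect_closure_common:
  assumes "x \<in> perfect_closure" "y \<in> perfect_closure"
  obtains n a b where "x ^ (2 ^ n) = to_ac a" "y ^ (2 ^ n) = to_ac b"
proof -
  obtain i j a b where "x ^ (2 ^ i) = to_ac a" "y ^ (2 ^ j) = to_ac b"
    using assms by (auto simp: perfect_closure_def)
  then have "x ^ (2 ^ (i + j)) = to_ac (a ^ (2 ^ j))" "y ^ (2 ^ (i + j)) = to_ac (b ^ (2 ^ i))"
    by (simp_all add: power_add power_mult) (metis mult.commute power_mult)
  then show ?thesis by (rule that)
qed

lemma perfect_closure_to_ac: "to_ac a \<in> perfect_closure"
  unfolding perfect_closure_def by (auto intro!: exI[of _ 0])

lemma perfect_closureI: "z ^ (2 ^ n) = to_ac a \<Longrightarrow> z \<in> perfect_closure"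
  unfolding perfect_closure_def by auto

lemma perfect_closure_add:
  assumes "x \<in> perfect_closure" "y \<in> perfect_closure" shows "x + y \<in> perfect_closure"
proof -
  obtain n a b where "x ^ (2 ^ n) = to_ac a" "y ^ (2 ^ n) = to_ac b"
    using perfect_closure_common[OF assms] .
  then have "(x + y) ^ (2 ^ n) = to_ac (a + b)" by (simp add: frobenius_add)
  then show ?thesis by (rule perfect_closureI)
qed

lemma perfect_closure_mult:
  assumes "x \<in> perfect_closure" "y \<in> perfect_closure" shows "x * y \<in> perfect_closure"
proof -
  obtain n a b where "x ^ (2 ^ n) = to_ac a" "y ^ (2 ^ n) = to_ac b"
    using perfect_closure_common[OF assms] .
  then have "(x * y) ^ (2 ^ n) = to_ac (a * b)" by (simp add: power_mult_distrib)
  then show ?thesis by (rule perfect_closureI)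
qed

lemma perfect_closure_uminus: "x \<in> perfect_closure \<Longrightarrow> - x \<in> perfect_closure"
  using perfect_closure_mult[of "to_ac (-1)" x] perfect_closure_to_ac[of "-1"] by simp

lemma perfect_closure_diff: "x \<in> perfect_closure \<Longrightarrow> y \<in> perfect_closure \<Longrightarrow> x - y \<in> perfect_closure"
  using perfect_closure_add[OF _ perfect_closure_uminus] by force

lemma perfect_closure_inverse:
  assumes "x \<in> perfect_closure" shows "inverse x \<in> perfect_closure"
proof -
  obtain n a where "x ^ (2 ^ n) = to_ac a" using assms by (auto simp: perfect_closure_def)
  then have "inverse x ^ (2 ^ n) = to_ac (inverse a)" by (simp add: power_inverse)
  then show ?thesis by (rule perfect_closureI)
qed

lemma perfect_closure_divide: "x \<in> perfect_closure \<Longrightarrow> y \<in> perfect_closure \<Longrightarrow> x / y \<in> perfect_closure"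
  using perfect_closure_mult[OF _ perfect_closure_inverse] by (simp add: divide_inverse)

typedef LL = perfect_closure
  using perfect_closure_to_ac by blast

setup_lifting type_definition_LL

instantiation LL :: "{field, kalg}"
begin

lift_definition zero_LL :: LL is 0 using perfect_closure_to_ac[of 0] by simp
lift_definition one_LL :: LL is 1 using perfect_closure_to_ac[of 1] by simp
lift_definition plus_LL :: "LL \<Rightarrow> LL \<Rightarrow> LL" is "(+)" by (rule perfect_closure_add)
lift_definition minus_LL :: "LL \<Rightarrow> LL \<Rightarrow> LL" is "(-)" by (rule perfect_closure_diff)
lift_definition times_LL :: "LL \<Rightarrow> LL \<Rightarrow> LL" is "(*)" by (rule perfect_closure_mult)
lift_definition divide_LL :: "LL \<Rightarrow> LL \<Rightarrow> LL" is "(/)" by (rule perfect_closure_divide)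
lift_definition uminus_LL :: "LL \<Rightarrow> LL" is uminus by (rule perfect_closure_uminus)
lift_definition inverse_LL :: "LL \<Rightarrow> LL" is inverse by (rule perfect_closure_inverse)
lift_definition kscale_LL :: "kk \<Rightarrow> LL \<Rightarrow> LL" is "\<lambda>(c::kk) z. to_ac c * z"
  by (intro perfect_closure_mult perfect_closure_to_ac)

instance
  by standard (transfer; simp add: algebra_simps divide_inverse)+

end

lemma LL_perfect: "\<exists>w :: LL. w ^ 2 = z"
proof -
  obtain v where v: "v ^ 2 = Rep_LL z"
    using nth_root_exists[of 2 "Rep_LL z"] by auto
  obtain n where "Rep_LL z ^ (2 ^ n) \<in> range to_ac"
    using Rep_LL[of z] by (auto simp: perfect_closure_def)
  then have "v ^ (2 ^ Suc n) \<in> range to_ac"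
    by (simp flip: v add: power_mult)
  then have "v \<in> perfect_closure" unfolding perfect_closure_def by blast
  then have "Abs_LL v ^ 2 = z"
    using v by (simp add: power2_eq_square times_LL_def Abs_LL_inverse Rep_LL_inverse)
  then show ?thesis ..
qed

section \<open>The algebra \<open>A\<close> and the base change map\<close>

text \<open>\<open>k[x,y]\<close> is represented as \<open>k[x][y]\<close>: the outer polynomial variable is \<open>y\<close>.\<close>

definition const_poly :: "kk \<Rightarrow> kk poly poly" where "const_poly c = [:[:c:]:]"
definition x_poly :: "kk poly poly" where "x_poly = [:[:0, 1:]:]"
definition y_poly :: "kk poly poly" where "y_poly = [:0, 1:]"

definition h_poly :: "kk poly poly" where
  "h_poly = x_poly ^ 2 + y_poly ^ 2 + const_poly t_kk * x_poly ^ 4 + const_poly s_kk * y_poly ^ 4"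

quotient_type AA = "kk poly poly" / "\<lambda>p q. h_poly dvd p - q"
proof (rule equivpI)
  show "reflp (\<lambda>p q. h_poly dvd p - q)" by (auto simp: reflp_def)
  show "symp (\<lambda>p q. h_poly dvd p - q)" 
  proof (rule sympI)
    fix p q assume "h_poly dvd p - q"
    moreover have "q - p = - (p - q)" by simp
    ultimately show "h_poly dvd q - p" by (simp only: dvd_minus_iff)
  qed
  show "transp (\<lambda>p q. h_poly dvd p - q)"
  proof (rule transpI)
    fix p q r assume "h_poly dvd p - q" "h_poly dvd q - r"
    from dvd_add[OF this] show "h_poly dvd p - r" by simp
  qed
qed

lemma s_kk_nonzero: "s_kk \<noteq> 0"
  by (simp add: s_kk_def Zero_fract_def eq_fract)

lemma h_poly_not_unit: "\<not> h_poly dvd 1"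
proof
  assume "h_poly dvd 1"
  then obtain q where q: "h_poly * q = 1" by (elim dvdE) simp
  then have "h_poly \<noteq> 0" "q \<noteq> 0" by auto
  then have "degree h_poly + degree q = degree (h_poly * q)" by (rule degree_mult_eq[symmetric])
  then have "degree h_poly + degree q = 0" unfolding q by simp
  moreover have h: "h_poly = [:[:0, 1:] ^ 2 + [:t_kk:] * [:0, 1:] ^ 4, 0, 1, 0, [:s_kk:]:]"
    by (simp add: h_poly_def x_poly_def y_poly_def const_poly_def eval_nat_numeral)
  have "degree h_poly = 4" unfolding h using s_kk_nonzero by simp
  ultimately show False by simp
qed

instantiation AA :: kalg
begin

lift_definition zero_AA :: AA is 0 .
lift_definition one_AA :: AA is 1 .
lift_definition plus_AA :: "AA \<Rightarrow> AA \<Rightarrow> AA" is "(+)"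
proof -
  fix p p' q q' assume "h_poly dvd p - p'" "h_poly dvd q - q'"
  from dvd_add[OF this] show "h_poly dvd p + q - (p' + q')" by (simp add: algebra_simps)
qed
lift_definition minus_AA :: "AA \<Rightarrow> AA \<Rightarrow> AA" is "(-)"
proof -
  fix p p' q q' assume "h_poly dvd p - p'" "h_poly dvd q - q'"
  from dvd_diff[OF this] show "h_poly dvd p - q - (p' - q')" by (simp add: algebra_simps)
qed
lift_definition uminus_AA :: "AA \<Rightarrow> AA" is uminus
proof -
  fix p p' assume "h_poly dvd p - p'"
  moreover have "- p - - p' = - (p - p')" by simp
  ultimately show "h_poly dvd - p - - p'" by (simp only: dvd_minus_iff)
qed
lift_definition times_AA :: "AA \<Rightarrow> AA \<Rightarrow> AA" is "(*)"
proof -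
  fix p p' q q' assume "h_poly dvd p - p'" "h_poly dvd q - q'"
  then have "h_poly dvd (p - p') * q + p' * (q - q')" by (intro dvd_add dvd_mult dvd_mult2)
  then show "h_poly dvd p * q - p' * q'" by (simp add: algebra_simps)
qed
lift_definition kscale_AA :: "kk \<Rightarrow> AA \<Rightarrow> AA" is "\<lambda>(c::kk) p. const_poly c * p"
  by (simp flip: right_diff_distrib)

lemma AA_abs_cases:
  obtains p where "a = abs_AA p"
  using Quotient3_abs_rep[OF Quotient3_AA, of a] by metis

instance
proof
  fix a b c :: AA and r r' :: kk
  have C: "const_poly (r + r') = const_poly r + const_poly r'"
    "const_poly (r * r') = const_poly r * const_poly r'" "const_poly 1 = 1"
    by (simp_all add: const_poly_def one_pCons)
  show "a + b + c = a + (b + c)" "a + b = b + a" "0 + a = a" "- a + a = 0" "a - b = a + - b"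
    "a * b * c = a * (b * c)" "a * b = b * a" "1 * a = a" "(a + b) * c = a * c + b * c"
    by (transfer; simp add: algebra_simps)+
  show "r *\<^sub>k (a + b) = r *\<^sub>k a + r *\<^sub>k b" "(r *\<^sub>k a) * b = r *\<^sub>k (a * b)"
    by (cases a rule: AA_abs_cases, cases b rule: AA_abs_cases;
        simp add: kscale_AA.abs_eq plus_AA.abs_eq times_AA.abs_eq algebra_simps)+
  show "(r + r') *\<^sub>k a = r *\<^sub>k a + r' *\<^sub>k a" "r *\<^sub>k (r' *\<^sub>k a) = (r * r') *\<^sub>k a" "1 *\<^sub>k a = a"
    by (cases a rule: AA_abs_cases;
        simp only: kscale_AA.abs_eq plus_AA.abs_eq C distrib_right mult.assoc mult_1_left)+
  show "0 \<noteq> (1 :: AA)" by transfer (simp add: h_poly_not_unit)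
qed

end

type_synonym AL = "(LL, AA) tensor"

text \<open>\<open>IDer\<^sub>k(A;4)\<close> as a \<open>k\<close>-module, so that its tensor product with \<open>L\<close> can be formed.\<close>

typedef IDer_A = "IDer (kscale :: kk \<Rightarrow> AA \<Rightarrow> AA) 4"
  using kalg.IDer_zero by blast

setup_lifting type_definition_IDer_A

instantiation IDer_A :: kmod
begin

lift_definition zero_IDer_A :: IDer_A is "\<lambda>x. 0" by (rule kalg.IDer_zero)
lift_definition plus_IDer_A :: "IDer_A \<Rightarrow> IDer_A \<Rightarrow> IDer_A" is "\<lambda>\<delta> \<epsilon> x. \<delta> x + \<epsilon> x"
  by (rule kalg.IDer_add)
lift_definition minus_IDer_A :: "IDer_A \<Rightarrow> IDer_A \<Rightarrow> IDer_A" is "\<lambda>\<delta> \<epsilon> x. \<delta> x - \<epsilon> x"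
  by (rule kalg.IDer_diff)
lift_definition uminus_IDer_A :: "IDer_A \<Rightarrow> IDer_A" is "\<lambda>\<delta> x. - \<delta> x"
  by (rule kalg.IDer_uminus)
lift_definition kscale_IDer_A :: "kk \<Rightarrow> IDer_A \<Rightarrow> IDer_A" is "\<lambda>(c::kk) \<delta> x. c *\<^sub>k \<delta> x"
  by (rule kalg.IDer_scale)

instance
  by standard
     (transfer; simp add: kscale_add_left kscale_add_right kscale_kscale kscale_one algebra_simps)+

end

text \<open>\<open>IDer\<^sub>L(A\<^sub>L;4)\<close>, with \<open>L\<close> acting by \<open>lmult\<close>; its \<open>k\<close>-module structure is the restriction of
  that action along \<open>k \<rightarrow> L\<close> (see \<open>lscale_kscale\<close>).\<close>

typedef IDer_AL = "IDer (lscale :: LL \<Rightarrow> AL \<Rightarrow> AL) 4"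
  using lalg.IDer_zero by blast

setup_lifting type_definition_IDer_AL

definition lmult :: "LL \<Rightarrow> IDer_AL \<Rightarrow> IDer_AL" where
  "lmult c \<delta> = Abs_IDer_AL (\<lambda>t. lscale c (Rep_IDer_AL \<delta> t))"

lemma Rep_lmult: "Rep_IDer_AL (lmult c \<delta>) = (\<lambda>t. lscale c (Rep_IDer_AL \<delta> t))"
  unfolding lmult_def by (intro Abs_IDer_AL_inverse lalg.IDer_scale Rep_IDer_AL)

lemma lscale_kscale: "lscale (c *\<^sub>k 1) t = c *\<^sub>k t"
  by (simp add: lscale_def tens_scale_left kscale_mult_left one_tensor_def[symmetric])

instantiation IDer_AL :: kmod
begin

lift_definition zero_IDer_AL :: IDer_AL is "\<lambda>x. 0" by (rule lalg.IDer_zero)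
lift_definition plus_IDer_AL :: "IDer_AL \<Rightarrow> IDer_AL \<Rightarrow> IDer_AL" is "\<lambda>\<delta> \<epsilon> x. \<delta> x + \<epsilon> x"
  by (rule lalg.IDer_add)
lift_definition minus_IDer_AL :: "IDer_AL \<Rightarrow> IDer_AL \<Rightarrow> IDer_AL" is "\<lambda>\<delta> \<epsilon> x. \<delta> x - \<epsilon> x"
  by (rule lalg.IDer_diff)
lift_definition uminus_IDer_AL :: "IDer_AL \<Rightarrow> IDer_AL" is "\<lambda>\<delta> x. - \<delta> x"
  by (rule lalg.IDer_uminus)
lift_definition kscale_IDer_AL :: "kk \<Rightarrow> IDer_AL \<Rightarrow> IDer_AL" is "\<lambda>(c::kk) \<delta> x. c *\<^sub>k \<delta> x"
  using lalg.IDer_scale[where c = "c *\<^sub>k 1" for c] by (simp only: lscale_kscale)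

instance
  by standard
     (transfer; simp add: kscale_add_left kscale_add_right kscale_kscale kscale_one algebra_simps)+

end

lift_definition extend_IDer_A :: "IDer_A \<Rightarrow> IDer_AL" is "extend_scalars :: (AA \<Rightarrow> AA) \<Rightarrow> AL \<Rightarrow> AL"
  by (rule extend_IDer)

definition base_change :: "(LL, IDer_A) tensor \<Rightarrow> IDer_AL" where
  "base_change = tensor_lift (\<lambda>c \<delta>. lmult c (extend_IDer_A \<delta>))"

lemma kbilinear_base_change: "kbilinear (\<lambda>c \<delta>. lmult c (extend_IDer_A \<delta>))"
proof -
  have hom: "module_hom kscale kscale \<delta>" if "\<delta> \<in> IDer kscale 4" for \<delta> :: "AA \<Rightarrow> AA"
    using that by (auto simp: IDer_def derivations_def)
  have add: "extend_scalars (\<lambda>x. \<delta> x + \<epsilon> x) t = extend_scalars \<delta> t + extend_scalars \<epsilon> t"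
    if "\<delta> \<in> IDer kscale 4" "\<epsilon> \<in> IDer kscale 4" for \<delta> \<epsilon> :: "AA \<Rightarrow> AA" and t :: AL
    by (induction t rule: tensor_induct)
       (simp_all add: extend_tens extend_add hom that kalg.IDer_add tens_add_right)
  have scale: "extend_scalars (\<lambda>x. c *\<^sub>k \<delta> x) t = c *\<^sub>k extend_scalars \<delta> t"
    if "\<delta> \<in> IDer kscale 4" for \<delta> :: "AA \<Rightarrow> AA" and t :: AL and c
    by (induction t rule: tensor_induct)
       (simp_all add: extend_tens extend_add hom that kalg.IDer_scale tens_scale_right kscale_add_right)
  have "lscale (c *\<^sub>k d) t = c *\<^sub>k lscale d t" "lscale d (c *\<^sub>k t) = c *\<^sub>k lscale d t"
    for c d and t :: AL
    by (simp_all add: lscale_def tens_scale_left kscale_mult_left kalg.scale_mult_right)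
  then show ?thesis
    by (simp add: kbilinear_def fun_eq_iff Rep_lmult extend_IDer_A.rep_eq
        plus_IDer_A.rep_eq kscale_IDer_A.rep_eq plus_IDer_AL.rep_eq kscale_IDer_AL.rep_eq
        add scale Rep_IDer_A lalg.scale_left_distrib lalg.scale_right_distrib
        flip: Rep_IDer_AL_inject)
qed

lemma base_change_tens: "base_change (c \<otimes>\<^sub>k \<delta>) = lmult c (extend_IDer_A \<delta>)"
  unfolding base_change_def by (rule tensor_lift_tens[OF kbilinear_base_change])

lemma base_change_add: "base_change (t + u) = base_change t + base_change u"
  unfolding base_change_def by (rule tensor_lift_add[OF kbilinear_base_change])

end

theory Submission
  imports Defs
begin

text \<open>A length-4 Hasse--Schmidt derivation with \<open>D\<^sub>1 x = u\<close>, \<open>D\<^sub>1 y = v\<close> applied to the relation \<open>h = 0\<close>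
  gives \<open>u\<^sup>2 + v\<^sup>2 = 0\<close> in degree 2, so \<open>u = v\<close> because \<open>A\<close> is reduced, and then
  \<open>(D\<^sub>2 x + D\<^sub>2 y)\<^sup>2 = (s + t) u\<^sup>4\<close> in degree 4. The derivations \<open>\<partial>/\<partial>s\<close> and \<open>\<partial>/\<partial>t\<close> of
  \<open>k[x,y]\<close> kill squares and satisfy \<open>\<partial>h/\<partial>s = y\<^sup>4\<close>, \<open>\<partial>h/\<partial>t = x\<^sup>4\<close>; combining them yields
  \<open>(x + y)\<^sup>4 u\<^sup>4 = 0\<close>, hence \<open>u = 0\<close>. So \<open>IDer\<^sub>k(A;4) = 0\<close>. Over \<open>L\<close>, on the other hand,
  \<open>h = g\<^sup>2\<close> is a square, and the nonzero derivation \<open>\<delta> = g \<partial>/\<partial>x\<close> satisfies \<open>\<delta>(a) \<delta>(b) = 0\<close>,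
  so that \<open>(Id, \<delta>, 0, 0, 0)\<close> is a Hasse--Schmidt derivation.\<close>

section \<open>Derivations of commutative rings\<close>

text \<open>Only additivity is imposed, since the derivations of \<open>k\<close> in
  \<open>s\<close> and \<open>t\<close> are not \<open>k\<close>-linear.\<close>

definition ring_derivation :: "('a::comm_ring_1 \<Rightarrow> 'a) \<Rightarrow> bool" where
  "ring_derivation d \<longleftrightarrow>
     (\<forall>x y. d (x + y) = d x + d y) \<and> (\<forall>x y. d (x * y) = x * d y + d x * y)"

lemma ring_derivationD:
  assumes "ring_derivation d"
  shows "d (x + y) = d x + d y" "d (x * y) = x * d y + d x * y"
  using assms by (auto simp: ring_derivation_def)

lemma ring_derivation_0: "ring_derivation d \<Longrightarrow> d 0 = 0"
  using ring_derivationD(1)[of d 0 0] by simp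

lemma ring_derivation_1: "ring_derivation d \<Longrightarrow> d 1 = 0"
  using ring_derivationD(2)[of d 1 1] by simp

lemma ring_derivation_diff: "ring_derivation d \<Longrightarrow> d (x - y) = d x - d y"
  using ring_derivationD(1)[of d "x - y" y] by (simp add: algebra_simps)

lemma ring_derivation_sum: "ring_derivation d \<Longrightarrow> d (sum f S) = (\<Sum>i\<in>S. d (f i))"
  by (induction S rule: infinite_finite_induct) (auto simp: ring_derivation_0 ring_derivationD)

lemma ring_derivation_square:
  assumes "ring_derivation d" "(2 :: 'a::comm_ring_1) = 0"
  shows "d ((x :: 'a)^2) = 0"
proof -
  have "d (x^2) = 2 * (x * d x)"
    by (simp only: power2_eq_square ring_derivationD[OF assms(1)] mult.commute[of "d x"] mult_2)
  then show ?thesis by (simp only: assms(2) mult_zero_left)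
qed

lemma ring_derivation_pderiv: "ring_derivation (pderiv :: 'a::idom poly \<Rightarrow> _)"
  by (simp add: ring_derivation_def pderiv_add pderiv_mult algebra_simps)

text \<open>Acting on coefficients kills the polynomial variable, so the Leibniz rule of
  \<open>d\<close> applies to each product of coefficients.\<close>

lemma ring_derivation_map_poly:
  assumes "ring_derivation d"
  shows "ring_derivation (map_poly d)"
  unfolding ring_derivation_def
proof (intro conjI allI)
  note [simp] = coeff_map_poly[where f = d, OF ring_derivation_0[OF assms]] ring_derivationD[OF assms]
  fix p q
  show "map_poly d (p + q) = map_poly d p + map_poly d q"
    by (rule poly_eqI) simp
  show "map_poly d (p * q) = p * map_poly d q + map_poly d p * q"
    by (rule poly_eqI) (simp add: coeff_mult ring_derivation_sum[OF assms] sum.distrib)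
qed

section \<open>Derivations of fraction fields\<close>

definition fract_derivation :: "('a::idom \<Rightarrow> 'a) \<Rightarrow> 'a fract \<Rightarrow> 'a fract" where
  "fract_derivation d q =
     (SOME r. \<exists>a b. b \<noteq> 0 \<and> q = Fract a b \<and> r = Fract (d a * b - a * d b) (b * b))"

text \<open>The quotient rule gives the same value on every representative, so \<open>SOME\<close>
  makes no real choice.\<close>

lemma fract_derivation_Fract:
  assumes d: "ring_derivation d" and b: "b \<noteq> 0"
  shows "fract_derivation d (Fract a b) = Fract (d a * b - a * d b) (b * b)"
  unfolding fract_derivation_def
proof (rule some_equality)
  show "\<exists>a' b'. b' \<noteq> 0 \<and> Fract a b = Fract a' b' \<and>
      Fract (d a * b - a * d b) (b * b) = Fract (d a' * b' - a' * d b') (b' * b')"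
    using b by blast
next
  fix r
  assume "\<exists>a' b'. b' \<noteq> 0 \<and> Fract a b = Fract a' b' \<and> r = Fract (d a' * b' - a' * d b') (b' * b')"
  then obtain a' b' where b': "b' \<noteq> 0" and eq: "a * b' = a' * b"
    and r: "r = Fract (d a' * b' - a' * d b') (b' * b')"
    using b by (auto simp: eq_fract)
  have "d (a * b') = d (a' * b)" by (simp only: eq)
  then have "a * d b' + d a * b' = a' * d b + d a' * b"
    by (simp only: ring_derivationD[OF d])
  \<comment> \<open>The difference of the cross products is a combination of the relation
    \<open>a * b' = a' * b\<close> and its derivative.\<close>
  moreover have "(d a * b - a * d b) * (b' * b') - (d a' * b' - a' * d b') * (b * b) =
      b * b' * ((a * d b' + d a * b') - (a' * d b + d a' * b)) + (a' * b - a * b') * (b' * d b + b * d b')"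
    by (simp add: algebra_simps)
  ultimately have "(d a' * b' - a' * d b') * (b * b) = (d a * b - a * d b) * (b' * b')"
    using eq by simp
  then show "r = Fract (d a * b - a * d b) (b * b)"
    using b b' by (simp add: r eq_fract)
qed

lemma ring_derivation_fract_derivation:
  assumes d: "ring_derivation d"
  shows "ring_derivation (fract_derivation d)"
  unfolding ring_derivation_def
proof (intro conjI allI)
  fix p q :: "'a fract"
  obtain a b a' b' where p: "p = Fract a b" "b \<noteq> 0" and q: "q = Fract a' b'" "b' \<noteq> 0"
    by (metis Fract_cases)
  note [simp] = ring_derivationD[OF d]
  show "fract_derivation d (p + q) = fract_derivation d p + fract_derivation d q"
    using p(2) q(2) unfolding p(1) q(1)
    by (simp add: fract_derivation_Fract[OF d] eq_fract algebra_simps)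
  show "fract_derivation d (p * q) = p * fract_derivation d q + fract_derivation d p * q"
    using p(2) q(2) unfolding p(1) q(1)
    by (simp add: fract_derivation_Fract[OF d] eq_fract algebra_simps)
qed

section \<open>The polynomial \<open>h\<close>\<close>

text \<open>Differentiates the constants in \<open>k\<close> and kills \<open>x\<close> and
  \<open>y\<close>. With \<open>pderiv\<close> for \<open>d\<close> it is the partial derivative in
  \<open>s\<close>, the outer variable of \<open>bit poly poly\<close>; with
  \<open>map_poly pderiv\<close> it is the one in \<open>t\<close>.\<close>

abbreviation const_derivation :: "(bit poly poly \<Rightarrow> bit poly poly) \<Rightarrow> kk poly poly \<Rightarrow> kk poly poly"
  where "const_derivation d \<equiv> map_poly (map_poly (fract_derivation d))"

lemma poly_poly_char2: "(2 :: kk poly poly) = 0"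
  by (simp add: numeral_poly kk_char2)

lemma const_poly_1: "const_poly 1 = 1"
  by (simp add: const_poly_def one_pCons)

lemma s_kk_plus_t_kk_nonzero: "s_kk + t_kk \<noteq> 0"
  by (simp add: s_kk_def t_kk_def Zero_fract_def eq_fract)

lemma h_poly_eq: "h_poly = [:[:0, 0, 1, 0, t_kk:], 0, 1, 0, [:s_kk:]:]"
  by (simp add: h_poly_def x_poly_def y_poly_def const_poly_def eval_nat_numeral)

lemma
  assumes d: "ring_derivation d"
  shows ring_derivation_const_derivation: "ring_derivation (const_derivation d)"
    and const_derivation_const: "const_derivation d (const_poly c) = const_poly (fract_derivation d c)"
proof -
  note f = ring_derivation_fract_derivation[OF d]
  note m = ring_derivation_map_poly[OF f]
  show "ring_derivation (const_derivation d)" by (rule ring_derivation_map_poly[OF m])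
  show "const_derivation d (const_poly c) = const_poly (fract_derivation d c)"
    by (simp add: const_poly_def map_poly_pCons ring_derivation_0[OF f] ring_derivation_0[OF m])
qed

lemma
  shows ds_s: "fract_derivation pderiv s_kk = 1"
    and ds_t: "fract_derivation pderiv t_kk = 0"
    and dt_s: "fract_derivation (map_poly pderiv) s_kk = 0"
    and dt_t: "fract_derivation (map_poly pderiv) t_kk = 1"
proof -
  note s = ring_derivation_pderiv[where 'a = "bit poly"]
  note t = ring_derivation_map_poly[OF ring_derivation_pderiv[where 'a = bit]]
  show "fract_derivation pderiv s_kk = 1" "fract_derivation pderiv t_kk = 0"
    by (simp_all add: s_kk_def t_kk_def fract_derivation_Fract[OF s] pderiv_pCons
        One_fract_def Zero_fract_def eq_fract pderiv_1)
  have "map_poly pderiv [:[:0, 1:]:] = (1 :: bit poly poly)"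
    by (simp add: map_poly_pCons pderiv_pCons) (simp only: one_pCons)
  then show "fract_derivation (map_poly pderiv) t_kk = 1"
    by (simp add: t_kk_def fract_derivation_Fract[OF t] One_fract_def ring_derivation_1[OF t])
  show "fract_derivation (map_poly pderiv) s_kk = 0"
    by (simp add: s_kk_def fract_derivation_Fract[OF t] map_poly_pCons pderiv_1
        Zero_fract_def eq_fract ring_derivation_1[OF t])
qed

text \<open>Each term of \<open>h\<close> is a constant times a square, and squares are killed, so
  only the constants get differentiated.\<close>

lemma ds_h: "const_derivation pderiv h_poly = y_poly ^ 4"
  and dt_h: "const_derivation (map_poly pderiv) h_poly = x_poly ^ 4"
proof -
  have *: "const_derivation d h_poly =
      x_poly ^ 4 * const_poly (fract_derivation d t_kk) + y_poly ^ 4 * const_poly (fract_derivation d s_kk)"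
    if d: "ring_derivation d" for d
  proof -
    note D = ring_derivation_const_derivation[OF d]
    have "const_derivation d (p ^ 4) = 0" for p
      using ring_derivation_square[OF D poly_poly_char2, of "p ^ 2"] by (simp flip: power_mult)
    then show ?thesis
      by (simp add: h_poly_def ring_derivationD[OF D] const_derivation_const[OF d]
          ring_derivation_square[OF D poly_poly_char2] mult.commute)
  qed
  show "const_derivation pderiv h_poly = y_poly ^ 4"
    using *[OF ring_derivation_pderiv] by (simp add: ds_s ds_t const_poly_1) (simp add: const_poly_def)
  show "const_derivation (map_poly pderiv) h_poly = x_poly ^ 4"
    using *[OF ring_derivation_map_poly[OF ring_derivation_pderiv]]
    by (simp add: dt_s dt_t const_poly_1) (simp add: const_poly_def)
qed

section \<open>Cancellation in divisibility by \<open>h\<close>\<close>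

lemma dvd_linear_mult_cancel:
  fixes h p :: "'a::idom poly"
  assumes "poly h a \<noteq> 0" "h dvd [:- a, 1:] * p"
  shows "h dvd p"
proof -
  obtain r where r: "[:- a, 1:] * p = h * r" using assms(2) by (elim dvdE)
  \<comment> \<open>Since \<open>h\<close> does not vanish at \<open>a\<close>, the cofactor
    \<open>r\<close> must, and so it absorbs the linear factor.\<close>
  have "poly (h * r) a = 0" by (simp flip: r)
  then have "poly r a = 0" using assms(1) by simp
  then obtain r' where r': "r = [:- a, 1:] * r'" by (auto simp: poly_eq_0_iff_dvd)
  have "[:- a, 1:] * p = [:- a, 1:] * (h * r')" unfolding r r' by (rule mult.left_commute)
  then have "p = h * r'" by (subst (asm) mult_cancel_left) simp
  then show ?thesis by simp
qed

lemma dvd_linear_power_mult_cancel: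
  fixes h p :: "'a::idom poly"
  assumes "poly h a \<noteq> 0" "h dvd [:- a, 1:] ^ n * p"
  shows "h dvd p"
  using assms(2)
proof (induction n)
  case (Suc n)
  then show ?case
    using dvd_linear_mult_cancel[OF assms(1)] by (simp only: power_Suc mult.assoc)
qed simp

lemma square_dvd_square_cancel:
  fixes h p :: "'a::idom poly"
  assumes char2: "(2 :: 'a poly) = 0" and unit: "lead_coeff h dvd 1" and dvd: "h ^ 2 dvd p ^ 2"
  shows "h dvd p"
proof -
  have h: "h \<noteq> 0" using unit by auto
  obtain q r where qr: "pseudo_divmod p h = (q, r)" by (cases "pseudo_divmod p h")
  \<comment> \<open>The coefficients need not form a field, so division with remainder works only
    after scaling \<open>p\<close> by \<open>c\<close>. This is a power of a unit and is removed at
    the end.\<close>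
  define c where "c = lead_coeff h ^ (Suc (degree p) - degree h)"
  have c: "smult c p = h * q + r" and r: "r = 0 \<or> degree r < degree h"
    using pseudo_divmod[OF h qr] by (auto simp: c_def)
  obtain e where e: "p ^ 2 = h ^ 2 * e" using dvd by (elim dvdE)
  have "r = smult c p - h * q" using c by simp
  then have "r ^ 2 = (smult c p) ^ 2 + (h * q) ^ 2"
    by (simp add: power2_diff char2)
  \<comment> \<open>characteristic 2 makes \<open>r\<^sup>2\<close> divisible by \<open>h\<^sup>2\<close>, which forces \<open>r = 0\<close> by degree\<close>
  also have "\<dots> = h ^ 2 * (smult (c ^ 2) e + q ^ 2)"
    by (simp add: power_mult_distrib smult_power e distrib_left)
  finally have dvd_r: "h ^ 2 dvd r ^ 2" by simp
  have "r = 0"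
  proof (rule ccontr)
    assume "r \<noteq> 0"
    with dvd_imp_degree_le[OF dvd_r] r h show False by (simp add: degree_power_eq)
  qed
  then have "h dvd smult c p" using c by simp
  moreover obtain c' where c': "1 = lead_coeff h * c'" using unit by (elim dvdE)
  have "c' ^ (Suc (degree p) - degree h) * c = (lead_coeff h * c') ^ (Suc (degree p) - degree h)"
    unfolding c_def by (simp only: power_mult_distrib mult.commute)
  then have "smult (c' ^ (Suc (degree p) - degree h)) (smult c p) = p"
    unfolding c'[symmetric] by simp
  ultimately show ?thesis using dvd_smult[of h "smult c p"] by metis
qed

lemma h_poly_lead_unit: "lead_coeff h_poly dvd 1"
  using s_kk_nonzero by (simp add: h_poly_eq is_unit_const_poly_iff dvd_field_iff)

text \<open>At \<open>y = 0\<close> the polynomial \<open>h\<close> becomes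
  \<open>x^2 + t x^4\<close>, which is nonzero.\<close>

lemma dvd_y_power_cancel:
  assumes "h_poly dvd y_poly ^ n * p" shows "h_poly dvd p"
proof (rule dvd_linear_power_mult_cancel)
  show "poly h_poly 0 \<noteq> 0" by (simp add: h_poly_eq)
  show "h_poly dvd [:- 0, 1:] ^ n * p" using assms by (simp add: y_poly_def)
qed

text \<open>In characteristic 2, \<open>x + y\<close> is the linear factor \<open>y - x\<close>; at
  \<open>y = x\<close> the quadratic terms of \<open>h\<close> cancel and \<open>(s + t) x^4\<close>
  remains.\<close>

lemma dvd_x_plus_y_power_cancel:
  assumes "h_poly dvd (x_poly + y_poly) ^ n * p" shows "h_poly dvd p"
proof (rule dvd_linear_power_mult_cancel)
  have 2: "(2 :: kk poly) = 0" by (simp add: numeral_poly kk_char2)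
  have "(1 :: kk) + 1 = 0" using kk_char2 by simp
  then have neg: "- (1 :: kk) = 1" by (rule minus_unique)
  have "poly h_poly [:0, 1:] = [:0, 0, 2, 0, s_kk + t_kk:]"
    by (simp add: h_poly_eq) (simp only: one_pCons, simp add: add.commute)
  then show "poly h_poly [:0, 1:] \<noteq> 0" using s_kk_plus_t_kk_nonzero by simp
  show "h_poly dvd [:- [:0, 1:], 1:] ^ n * p"
    using assms by (simp add: x_poly_def y_poly_def neg)
qed

text \<open>Behind the reducedness of \<open>A\<close>: differentiating \<open>p^2 = h q\<close> in
  \<open>s\<close> shows that \<open>h\<close> divides \<open>y^4 q\<close>, hence \<open>q\<close>.
  So \<open>h^2\<close> divides \<open>p^2\<close>, and the squares cancel.\<close>

lemma h_dvd_square: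
  assumes "h_poly dvd p ^ 2" shows "h_poly dvd p"
proof -
  note ds = ring_derivation_const_derivation[OF ring_derivation_pderiv]
  obtain q where q: "p ^ 2 = h_poly * q" using assms by (elim dvdE)
  have "const_derivation pderiv (p ^ 2) = 0"
    by (rule ring_derivation_square[OF ds poly_poly_char2])
  then have "h_poly * const_derivation pderiv q + y_poly ^ 4 * q = 0"
    by (simp only: q ring_derivationD[OF ds] ds_h)
  then have "y_poly ^ 4 * q = h_poly * (- const_derivation pderiv q)"
    by (simp add: eq_neg_iff_add_eq_0 add.commute)
  then have "h_poly dvd y_poly ^ 4 * q" by simp
  then have "h_poly dvd q" by (rule dvd_y_power_cancel)
  then have "h_poly ^ 2 dvd p ^ 2"
    unfolding q unfolding power2_eq_square by (rule mult_dvd_mono[OF dvd_refl])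
  then show ?thesis
    by (rule square_dvd_square_cancel[OF poly_poly_char2 h_poly_lead_unit])
qed

text \<open>Polynomial form of the degree 4 condition, with \<open>w\<close> for
  \<open>D 2 x + D 2 y\<close>. Differentiating in \<open>s\<close> and in \<open>t\<close> gives
  two relations in the same unknown cofactor \<open>q\<close>, which is then eliminated.\<close>

lemma h_dvd_of_square_eq:
  assumes "h_poly dvd w ^ 2 - const_poly (s_kk + t_kk) * u ^ 4"
  shows "h_poly dvd u"
proof -
  obtain q where q: "w ^ 2 - const_poly (s_kk + t_kk) * u ^ 4 = h_poly * q" using assms by (elim dvdE)
  \<comment> \<open>Both derivations send \<open>s + t\<close> to 1, so one computation serves for
    the two.\<close>
  have main: "h_poly dvd u ^ 4 + const_derivation d h_poly * q"
    if d: "ring_derivation d" and 1: "fract_derivation d (s_kk + t_kk) = 1" for d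
  proof -
    note D = ring_derivation_const_derivation[OF d]
    have "const_derivation d (w ^ 2) = 0"
      by (rule ring_derivation_square[OF D poly_poly_char2])
    moreover have "const_derivation d (u ^ 4) = 0"
      using ring_derivation_square[OF D poly_poly_char2, of "u ^ 2"] by (simp flip: power_mult)
    ultimately have "const_derivation d (w ^ 2 - const_poly (s_kk + t_kk) * u ^ 4) = - (u ^ 4)"
      by (simp add: ring_derivation_diff[OF D] ring_derivationD(2)[OF D] const_derivation_const[OF d]
          1 const_poly_1)
    then have "- (u ^ 4) = h_poly * const_derivation d q + const_derivation d h_poly * q"
      by (simp only: q ring_derivationD[OF D])
    then have "u ^ 4 + const_derivation d h_poly * q = h_poly * (- const_derivation d q)"
      by (simp only: neg_eq_iff_add_eq_0 eq_neg_iff_add_eq_0 mult_minus_right ac_simps)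
    then show ?thesis by simp
  qed
  note t = ring_derivation_map_poly[OF ring_derivation_pderiv]
  have s: "h_poly dvd u ^ 4 + y_poly ^ 4 * q"
    using main[OF ring_derivation_pderiv]
    by (simp only: ds_h
        ring_derivationD[OF ring_derivation_fract_derivation[OF ring_derivation_pderiv]] ds_s ds_t simp_thms add_0_right)
  have t: "h_poly dvd u ^ 4 + x_poly ^ 4 * q"
    using main[OF t]
    by (simp only: dt_h ring_derivationD[OF ring_derivation_fract_derivation[OF t]] dt_s dt_t
        simp_thms add_0_left)
  have "(x_poly + y_poly) ^ 4 = ((x_poly + y_poly) ^ 2) ^ 2" by (simp flip: power_mult)
  also have "\<dots> = (x_poly ^ 2) ^ 2 + (y_poly ^ 2) ^ 2" by (simp add: power2_sum poly_poly_char2)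
  also have "\<dots> = x_poly ^ 4 + y_poly ^ 4" by (simp flip: power_mult)
  finally have frob: "(x_poly + y_poly) ^ 4 = x_poly ^ 4 + y_poly ^ 4" .
  \<comment> \<open>These weights make the two terms in \<open>q\<close> equal, so they cancel in
    characteristic 2.\<close>
  have "h_poly dvd x_poly ^ 4 * (u ^ 4 + y_poly ^ 4 * q) + y_poly ^ 4 * (u ^ 4 + x_poly ^ 4 * q)"
    by (rule dvd_add[OF dvd_mult[OF s] dvd_mult[OF t]])
  also have "\<dots> = (x_poly + y_poly) ^ 4 * u ^ 4 + 2 * (x_poly ^ 4 * y_poly ^ 4 * q)"
    unfolding frob by (simp add: algebra_simps)
  also have "\<dots> = (x_poly + y_poly) ^ 4 * u ^ 4" by (simp only: poly_poly_char2 mult_zero_left add_0_right)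
  finally have "h_poly dvd u ^ 4" by (rule dvd_x_plus_y_power_cancel)
  also have "u ^ 4 = (u ^ 2) ^ 2" by (simp flip: power_mult)
  finally show ?thesis by (rule h_dvd_square[OF h_dvd_square])
qed

section \<open>The algebra \<open>A\<close>\<close>

lemma kmod_char2: "(x :: 'a::kmod) + x = 0"
  using kscale_add_left[of 1 1 x] kk_char2 by (simp add: kscale_one)

lemma kalg_char2: "(2 :: 'a::kalg) = 0"
  using kmod_char2[of "1 :: 'a"] by simp

lemma kalg_square_add: "((x :: 'a::kalg) + y) ^ 2 = x ^ 2 + y ^ 2"
  by (simp add: power2_sum kalg_char2)

lemma AA_reduced:
  assumes "(a :: AA) ^ 2 = 0" shows "a = 0"
proof -
  obtain p where a: "a = abs_AA p" by (rule AA_abs_cases)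
  have "h_poly dvd p * p - 0"
    using assms unfolding a power2_eq_square by (simp only: times_AA.abs_eq zero_AA_def AA.abs_eq_iff)
  then have "h_poly dvd p" by (intro h_dvd_square[of p]) (simp add: power2_eq_square)
  then show ?thesis by (simp add: a zero_AA_def AA.abs_eq_iff)
qed

lemma AA_square_eq_zero:
  assumes "(w :: AA) ^ 2 = (s_kk + t_kk) *\<^sub>k u ^ 4" shows "u = 0"
proof -
  obtain p q where a: "u = abs_AA p" "w = abs_AA q" by (metis AA_abs_cases)
  have "h_poly dvd q * q - const_poly (s_kk + t_kk) * (p * p * p * p)"
    using assms unfolding a power2_eq_square power4_eq_xxxx
    by (simp only: times_AA.abs_eq kscale_AA.abs_eq AA.abs_eq_iff)
  then have "h_poly dvd p"
    by (intro h_dvd_of_square_eq[of q p]) (simp only: power2_eq_square power4_eq_xxxx)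
  then show ?thesis by (simp add: a zero_AA_def AA.abs_eq_iff)
qed

lift_definition x_AA :: AA is x_poly .
lift_definition y_AA :: AA is y_poly .

lemma AA_relation: "x_AA ^ 2 + y_AA ^ 2 + t_kk *\<^sub>k x_AA ^ 4 + s_kk *\<^sub>k y_AA ^ 4 = 0"
proof -
  have "x_AA * x_AA + y_AA * y_AA + t_kk *\<^sub>k (x_AA * x_AA * x_AA * x_AA) +
      s_kk *\<^sub>k (y_AA * y_AA * y_AA * y_AA) = 0"
    by transfer (simp add: h_poly_def power2_eq_square power4_eq_xxxx)
  then show ?thesis by (simp add: power2_eq_square power4_eq_xxxx)
qed

lemma derivation_AA_eq_zero:
  assumes "\<delta> \<in> derivations kscale" "\<delta> x_AA = 0" "\<delta> y_AA = 0"
  shows "\<delta> a = 0"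
proof -
  have add: "\<delta> (a + b) = \<delta> a + \<delta> b" and scale: "\<delta> (c *\<^sub>k a) = c *\<^sub>k \<delta> a"
    and mult: "\<delta> (a * b) = a * \<delta> b + \<delta> a * b" for a b c
    using assms(1) by (auto simp: derivations_def kalg.module_hom_iff)
  have one: "\<delta> 1 = 0" using mult[of 1 1] by simp
  have zero: "\<delta> 0 = 0" using add[of 0 0] by simp
  have x: "\<delta> (abs_AA [:p:]) = 0" for p
  proof (induction p)
    case (pCons c p)
    have "[:pCons c p:] = const_poly c * 1 + x_poly * [:p:]"
      by (simp add: const_poly_def x_poly_def)
    then have "abs_AA [:pCons c p:] = c *\<^sub>k 1 + x_AA * abs_AA [:p:]"
      by (simp add: plus_AA.abs_eq times_AA.abs_eq kscale_AA.abs_eq x_AA.abs_eq one_AA.abs_eq)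
    then show ?case using pCons by (simp add: add scale mult one assms)
  qed (simp add: zero flip: zero_AA.abs_eq)
  have "\<delta> (abs_AA p) = 0" for p
  proof (induction p)
    case (pCons c p)
    have "pCons c p = [:c:] + y_poly * p" by (simp add: y_poly_def)
    then have "abs_AA (pCons c p) = abs_AA [:c:] + y_AA * abs_AA p"
      by (simp add: plus_AA.abs_eq times_AA.abs_eq y_AA.abs_eq)
    then show ?case using pCons by (simp add: add mult x assms)
  qed (simp add: zero flip: zero_AA.abs_eq)
  then show ?thesis by (cases a rule: AA_abs_cases) simp
qed

section \<open>Hasse-Schmidt derivations of length 4 in characteristic 2\<close>

lemma hasse_schmidt_square:
  fixes D :: "nat \<Rightarrow> 'a::kalg \<Rightarrow> 'a"
  assumes D: "hasse_schmidt kscale 4 D"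
  shows "D 2 (x ^ 2) = (D 1 x) ^ 2" "D 4 (x ^ 2) = (D 2 x) ^ 2"
proof -
  have id: "D 0 x = x" using hasse_schmidt_D(2)[OF D] by simp
  have sum: "(\<Sum>i\<le>2. f i) = f 0 + f 1 + f 2" "(\<Sum>i\<le>4. f i) = f 0 + f 1 + f 2 + f 3 + f 4"
    for f :: "nat \<Rightarrow> 'a"
    by (simp_all add: eval_nat_numeral)
  have "D 2 (x ^ 2) = x * D 2 x + D 1 x * D 1 x + D 2 x * x"
    using hasse_schmidt_D(3)[OF D, of 2 x x] unfolding sum power2_eq_square by (simp add: id)
  \<comment> \<open>The terms at \<open>i\<close> and \<open>n - i\<close> are equal and cancel in
    pairs; only the middle one survives.\<close>
  also have "\<dots> = D 1 x * D 1 x + (x * D 2 x + x * D 2 x)"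
    by (simp only: ac_simps)
  finally show "D 2 (x ^ 2) = (D 1 x) ^ 2"
    by (simp only: kmod_char2 add_0_right power2_eq_square)
  have "D 4 (x ^ 2) = x * D 4 x + D 1 x * D 3 x + D 2 x * D 2 x + D 3 x * D 1 x + D 4 x * x"
    using hasse_schmidt_D(3)[OF D, of 4 x x] unfolding sum power2_eq_square by (simp add: id)
  also have "\<dots> = D 2 x * D 2 x + (x * D 4 x + x * D 4 x) + (D 1 x * D 3 x + D 1 x * D 3 x)"
    by (simp only: ac_simps)
  finally show "D 4 (x ^ 2) = (D 2 x) ^ 2"
    by (simp only: kmod_char2 add_0_right power2_eq_square)
qed

lemma IDer_AA_zero:
  assumes "\<delta> \<in> IDer (kscale :: kk \<Rightarrow> AA \<Rightarrow> AA) 4"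
  shows "\<delta> a = 0"
proof -
  obtain D where D: "hasse_schmidt kscale 4 D" "D 1 = \<delta>" and d: "\<delta> \<in> derivations kscale"
    using assms by (auto simp: IDer_def)
  have hom: "D i (a + b) = D i a + D i b" "D i (c *\<^sub>k a) = c *\<^sub>k D i a" if "i \<le> 4" for i a b c
    using hasse_schmidt_D(1)[OF D(1) that] by (auto simp: kalg.module_hom_iff)
  have zero: "D i 0 = 0" if "i \<le> 4" for i using hom(2)[OF that, of 0 0] by simp
  note sq = hasse_schmidt_square[OF D(1)]
  \<comment> \<open>Makes the quartic terms invisible to \<open>D 2\<close>, because
    \<open>D 2 (a ^ 4) = (D 1 (a ^ 2)) ^ 2\<close>.\<close>
  have dsq: "\<delta> (a ^ 2) = 0" for a
  proof -
    have "\<delta> (a ^ 2) = a * \<delta> a + a * \<delta> a"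
      using d by (simp add: derivations_def power2_eq_square mult.commute)
    then show ?thesis by (simp only: kmod_char2)
  qed
  have p4: "a ^ 4 = (a ^ 2) ^ 2" for a :: AA by (simp flip: power_mult)
  have le2: "(2::nat) \<le> 4" and le4: "(4::nat) \<le> 4" by simp_all
  define u v u2 v2 where "u = \<delta> x_AA" "v = \<delta> y_AA" "u2 = D 2 x_AA" "v2 = D 2 y_AA"
  have "D 2 (x_AA ^ 2 + y_AA ^ 2 + t_kk *\<^sub>k x_AA ^ 4 + s_kk *\<^sub>k y_AA ^ 4) = (u + v) ^ 2"
    by (simp only: hom[of 2] p4 sq D(2) dsq kalg_square_add u_v_u2_v2_def le2 zero_power2
        kmod.scale_zero_right add_0_right)
  then have "(u + v) ^ 2 = 0" by (simp only: AA_relation zero[OF le2])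
  then have "u + v = u + u" by (simp only: kmod_char2 AA_reduced)
  then have uv: "v = u" by (rule add_left_imp_eq)
  \<comment> \<open>Two uses of the square rule give
    \<open>D 4 (a ^ 4) = (D 2 (a ^ 2)) ^ 2 = (D 1 a) ^ 4\<close>; as \<open>v = u\<close>, the
    coefficients add up to \<open>s + t\<close>.\<close>
  have "D 4 (x_AA ^ 2 + y_AA ^ 2 + t_kk *\<^sub>k x_AA ^ 4 + s_kk *\<^sub>k y_AA ^ 4) =
      (u2 + v2) ^ 2 + (s_kk + t_kk) *\<^sub>k u ^ 4"
    by (simp only: hom[of 4] p4 sq D(2) kalg_square_add u_v_u2_v2_def[symmetric] uv kscale_add_left
        le4 ac_simps)
  then have "(u2 + v2) ^ 2 + (s_kk + t_kk) *\<^sub>k u ^ 4 = (s_kk + t_kk) *\<^sub>k u ^ 4 + (s_kk + t_kk) *\<^sub>k u ^ 4"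
    by (simp only: AA_relation zero[OF le4] kmod_char2)
  then have "(u2 + v2) ^ 2 = (s_kk + t_kk) *\<^sub>k u ^ 4" by (rule add_right_imp_eq)
  then have "u = 0" by (rule AA_square_eq_zero)
  then have "\<delta> x_AA = 0" "\<delta> y_AA = 0" using uv by (simp_all add: u_v_u2_v2_def)
  then show ?thesis by (rule derivation_AA_eq_zero[OF d])
qed

section \<open>A nilpotent derivation of \<open>A\<^sub>L\<close>\<close>

text \<open>Only even powers of \<open>x\<close> occur in \<open>h\<close>. This is what lets the
  partial derivative in \<open>x\<close> descend to \<open>A\<close>.\<close>

lemma dx_h: "map_poly pderiv h_poly = 0"
proof -
  have "(4 :: kk) = 2 * 2" by simp
  also have "\<dots> = 0" by (simp only: kk_char2 mult_zero_left)
  finally show ?thesis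
    by (simp add: h_poly_eq map_poly_pCons pderiv_pCons kk_char2)
qed

lift_definition dx_AA :: "AA \<Rightarrow> AA" is "map_poly pderiv"
proof -
  fix p q :: "kk poly poly"
  note dx = ring_derivation_map_poly[OF ring_derivation_pderiv[where 'a = kk]]
  assume "h_poly dvd p - q"
  then obtain r where "p - q = h_poly * r" by (elim dvdE)
  then have "map_poly pderiv p - map_poly pderiv q = h_poly * map_poly pderiv r"
    using ring_derivation_diff[OF dx, of p q] by (simp add: ring_derivationD[OF dx] dx_h)
  then show "h_poly dvd map_poly pderiv p - map_poly pderiv q" by simp
qed

lemma dx_AA_derivation: "dx_AA \<in> derivations kscale"
proof -
  note dx = ring_derivation_map_poly[OF ring_derivation_pderiv[where 'a = kk]]
  have C: "map_poly pderiv (const_poly c) = 0" for c :: kk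
    by (simp add: const_poly_def map_poly_pCons)
  have "dx_AA (x + y) = dx_AA x + dx_AA y" "dx_AA (x * y) = x * dx_AA y + dx_AA x * y"
    "dx_AA (c *\<^sub>k x) = c *\<^sub>k dx_AA x" for x y c
    by (transfer; simp add: ring_derivationD[OF dx] C)+
  then show ?thesis by (simp add: derivations_def kalg.module_hom_iff)
qed

lemma dx_AA_x: "dx_AA x_AA = 1"
proof -
  have "map_poly pderiv x_poly = 1"
    by (simp add: x_poly_def map_poly_pCons pderiv_pCons) (simp only: one_pCons)
  then show ?thesis by transfer simp
qed

text \<open>The coefficient of \<open>x\<^sup>0 y\<^sup>1\<close> is well defined on \<open>A\<close> because \<open>h\<close> lies in the ideal
  \<open>(x\<^sup>2, y\<^sup>2)\<close>.\<close>

definition coeff_y :: "AA \<Rightarrow> kk" where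
  "coeff_y a = coeff (coeff (rep_AA a) 1) 0"

lemma coeff_y_abs: "coeff_y (abs_AA p) = coeff (coeff p 1) 0"
proof -
  have "h_poly dvd rep_AA (abs_AA p) - p"
    using Quotient3_rep_abs[OF Quotient3_AA, of p] by simp
  then obtain r where "rep_AA (abs_AA p) - p = h_poly * r" by (elim dvdE)
  moreover have "coeff (coeff (h_poly * r) 1) 0 = 0"
    by (simp add: h_poly_eq coeff_mult coeff_pCons)
  ultimately have "coeff (coeff (rep_AA (abs_AA p) - p) 1) 0 = 0" by simp
  then show ?thesis by (simp add: coeff_y_def)
qed

lemma IDer_of_square_zero:
  fixes \<delta> :: "'a::comm_ring_1 \<Rightarrow> 'a"
  assumes "comm_algebra scale" "\<delta> \<in> derivations scale" "\<And>x y. \<delta> x * \<delta> y = 0"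
  shows "\<delta> \<in> IDer scale m"
proof -
  interpret comm_algebra scale by fact
  define D where "D i = (if i = 0 then id else if i = 1 then \<delta> else (\<lambda>_. 0))" for i :: nat
  have \<delta>: "module_hom scale scale \<delta>" "\<delta> (x * y) = x * \<delta> y + \<delta> x * y" for x y
    using assms(2) by (auto simp: derivations_def)
  have "hasse_schmidt scale m D"
    unfolding hasse_schmidt_def
  proof (intro conjI allI impI)
    fix i show "module_hom scale scale (D i)"
      using \<delta>(1) by (auto simp: D_def module_hom_iff)
  next
    show "D 0 = id" by (simp add: D_def)
  next
    fix n x y
    show "D n (x * y) = (\<Sum>i\<le>n. D i x * D (n - i) y)"
    proof (cases "n \<le> 1")
      case True
      then consider "n = 0" | "n = 1" by linarith
      then show ?thesis by cases (simp_all add: D_def \<delta>(2))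
    next
      case False
      \<comment> \<open>For \<open>n \<ge> 2\<close> some index exceeds 1 and its factor is 0,
        unless \<open>i = n - i = 1\<close>, where the product is
        \<open>\<delta> x * \<delta> y\<close>.\<close>
      have "D i x * D (n - i) y = 0" for i
        using False assms(3) by (auto simp: D_def)
      moreover have "D n (x * y) = 0" using False by (simp add: D_def)
      ultimately show ?thesis by (simp only: sum.neutral_const)
    qed
  qed
  moreover have "D 1 = \<delta>" by (simp add: D_def)
  ultimately show ?thesis using assms(2) by (auto simp: IDer_def)
qed

lemma IDer_AL_nonzero: "\<exists>\<delta> \<in> IDer (lscale :: LL \<Rightarrow> AL \<Rightarrow> AL) 4. \<delta> (1 \<otimes>\<^sub>k x_AA) \<noteq> 0"
proof -
  obtain \<sigma> \<tau> :: LL where roots: "\<sigma> ^ 2 = s_kk *\<^sub>k 1" "\<tau> ^ 2 = t_kk *\<^sub>k 1"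
    using LL_perfect[of "s_kk *\<^sub>k 1"] LL_perfect[of "t_kk *\<^sub>k 1"] by blast
  \<comment> \<open>The square root of \<open>h\<close> over \<open>L\<close>, found by taking roots
    of the coefficients, since squaring is additive.\<close>
  define g :: AL where
    "g = 1 \<otimes>\<^sub>k x_AA + 1 \<otimes>\<^sub>k y_AA + \<tau> \<otimes>\<^sub>k (x_AA ^ 2) + \<sigma> \<otimes>\<^sub>k (y_AA ^ 2)"
  have sq: "(c \<otimes>\<^sub>k a) ^ 2 = (c ^ 2) \<otimes>\<^sub>k (a ^ 2)" for c :: LL and a :: AA
    by (simp add: power2_eq_square tens_times_tens)
  have "g ^ 2 = 1 \<otimes>\<^sub>k (x_AA ^ 2 + y_AA ^ 2 + t_kk *\<^sub>k x_AA ^ 4 + s_kk *\<^sub>k y_AA ^ 4)"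
    by (simp add: g_def kalg_square_add sq roots tens_scale_left tens_scale_right tens_add_right
        flip: power_mult)
  then have "g ^ 2 = 0"
    using tens_scale_right[of "1 :: LL" 0 "0 :: AA"] by (simp only: AA_relation kmod.scale_zero_left)
  then have g2: "g * g = 0" by (simp only: power2_eq_square)
  define d where "d = (extend_scalars dx_AA :: AL \<Rightarrow> AL)"
  have d: "d \<in> derivations lscale" unfolding d_def by (rule extend_derivations[OF dx_AA_derivation])
  have "(\<lambda>a. g * d a) \<in> IDer lscale 4"
  proof (rule IDer_of_square_zero)
    show "comm_algebra (lscale :: LL \<Rightarrow> AL \<Rightarrow> AL)" by (rule lalg.comm_algebra_axioms)
    show "(\<lambda>a. g * d a) \<in> derivations lscale" by (rule lalg.derivations_mult[OF d])
    show "g * d a * (g * d b) = 0" for a b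
    proof -
      have "g * d a * (g * d b) = g * g * (d a * d b)" by (simp only: ac_simps)
      then show ?thesis by (simp only: g2 mult_zero_left)
    qed
  qed
  \<comment> \<open>As \<open>d\<close> sends \<open>x\<close> to 1, the value is \<open>g\<close>
    itself, so it remains to see that \<open>g\<close> is nonzero in \<open>A_L\<close>.\<close>
  moreover have "g * d (1 \<otimes>\<^sub>k x_AA) \<noteq> 0"
  proof
    assume "g * d (1 \<otimes>\<^sub>k x_AA) = 0"
    moreover have "module_hom kscale kscale dx_AA"
      using dx_AA_derivation by (simp add: derivations_def)
    ultimately have g0: "g = 0"
      unfolding d_def by (simp only: extend_tens dx_AA_x one_tensor_def[symmetric] mult_1_right)
    have lin: "coeff_y (a + b) = coeff_y a + coeff_y b" "coeff_y (c *\<^sub>k a) = c * coeff_y a" for a b c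
      by (cases a rule: AA_abs_cases, cases b rule: AA_abs_cases;
          simp add: plus_AA.abs_eq kscale_AA.abs_eq coeff_y_abs const_poly_def)+
    \<comment> \<open>The induced map from \<open>A_L\<close> to \<open>L\<close> detects
      \<open>g\<close>: it sends the summand \<open>1 \<otimes>\<^sub>k y_AA\<close> to 1 and the
      other three to 0.\<close>
    then have bil: "kbilinear (\<lambda>(c::LL) a. coeff_y a *\<^sub>k c)"
      by (simp add: kbilinear_def kscale_add_left kscale_add_right kscale_kscale mult.commute)
    have "coeff_y x_AA = 0" "coeff_y y_AA = 1" "coeff_y (x_AA * x_AA) = 0" "coeff_y (y_AA * y_AA) = 0"
      by (simp_all add: x_AA.abs_eq y_AA.abs_eq times_AA.abs_eq coeff_y_abs x_poly_def y_poly_def)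
    then have "tensor_lift (\<lambda>(c::LL) a. coeff_y a *\<^sub>k c) g = 1"
      by (simp add: g_def tensor_lift_add[OF bil] tensor_lift_tens[OF bil] power2_eq_square kscale_one)
    moreover have "tensor_lift (\<lambda>(c::LL) a. coeff_y a *\<^sub>k c) 0 = 0"
      using tensor_lift_scale[OF bil, of 0 0] by simp
    ultimately show False using g0 by simp
  qed
  ultimately show ?thesis by (rule bexI[where x = "\<lambda>a. g * d a", rotated])
qed

section \<open>Failure of surjectivity\<close>

theorem mainTheorem3:
  shows "\<not> surj (base_change :: (LL, IDer_A) tensor \<Rightarrow> IDer_AL)"
proof
  assume surj: "surj (base_change :: (LL, IDer_A) tensor \<Rightarrow> IDer_AL)"
  have zero: "\<delta> = 0" for \<delta> :: IDer_A
    using IDer_AA_zero[OF Rep_IDer_A[of \<delta>]]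
    by (simp add: zero_IDer_A.rep_eq fun_eq_iff flip: Rep_IDer_A_inject)
  have "base_change t = 0" for t
  proof (induction t rule: tensor_induct)
    case (tens c \<delta>)
    \<comment> \<open>Since \<open>\<delta> = 0\<close>, the pure tensor is its own multiple by 0,
      and linearity of the base change map finishes the case.\<close>
    have "c \<otimes>\<^sub>k \<delta> = 0 *\<^sub>k (c \<otimes>\<^sub>k \<delta>)"
      using tens_scale_right[of c 0 \<delta>] zero[of \<delta>] by simp
    then have "base_change (c \<otimes>\<^sub>k \<delta>) = base_change (0 *\<^sub>k (c \<otimes>\<^sub>k \<delta>))" by (rule arg_cong)
    also have "\<dots> = 0 *\<^sub>k base_change (c \<otimes>\<^sub>k \<delta>)"
      unfolding base_change_def by (rule tensor_lift_scale[OF kbilinear_base_change])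
    finally show ?case by simp
  next
    case (add t u)
    then show ?case by (simp add: base_change_add)
  qed
  then have all_zero: "\<epsilon> = 0" for \<epsilon> :: IDer_AL using surjD[OF surj, of \<epsilon>] by auto
  obtain \<delta> where \<delta>: "\<delta> \<in> IDer (lscale :: LL \<Rightarrow> AL \<Rightarrow> AL) 4" "\<delta> (1 \<otimes>\<^sub>k x_AA) \<noteq> 0"
    using IDer_AL_nonzero by blast
  have "\<delta> = Rep_IDer_AL (Abs_IDer_AL \<delta>)" by (simp only: Abs_IDer_AL_inverse[OF \<delta>(1)])
  also have "\<dots> = Rep_IDer_AL 0" by (rule arg_cong[OF all_zero])
  finally show False using \<delta>(2) by (simp add: zero_IDer_AL.rep_eq)
qed

end
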